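(* Let $q=3^m$ with $m\ge 2$, let $n\ge 2$ be an integer written as $n=3^h s$ with $h\ge0$ and $\gcd(s,3)=1$, and let $a\in\mathbb{F}_q^*$. Then $H_n(a)=H(a)+h$.
   Context: $\mathbb{F}_q\subset\mathbb{F}_{q^n}$. $\mathrm{Tr}$ is the absolute trace $\mathbb{F}_q\to\mathbb{F}_3$, $\mathrm{Tr}(x)=\sum_{j=0}^{m-1}x^{3^j}$, and $\mathrm{Tr}_{q^n\to q}(x)=x+x^q+\dots+x^{q^{n-1}}$. With $\omega=e^{2\pi i/3}$, $e(c)=\omega^{\mathrm{Tr}(c)}$ for $c\in\mathbb{F}_q$ and $e_n(b)=\omega^{\mathrm{Tr}(\mathrm{Tr}_{q^n\to q}(b))}$ for $b\in\mathbb{F}_{q^n}$. Define $K(a)=\sum_{x\in\mathbb{F}_q}e(x+a/x)$ and $K_n(a)=\sum_{x\in\mathbb{F}_{q^n}}e_n(x+a/x)$, where $a/x=a\,x^{Q-2}$ in a field of order $Q$ (so the term $x=0$ contributes $1$). $H(a)$ is the largest $k$ with $3^k\mid K(a)$ and $H_n(a)$ the largest $k$ with $3^k\mid K_n(a)$, with the convention that if $K(a)=0$ then $H(a)=m$, and if $K_n(a)=0$ then $H_n(a)=mn$. *)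

theory Defs
  imports Complex_Main
begin

definition omega3 :: complex where
  "omega3 = cis (2 * pi / 3)"

definition abs_trace :: "nat \<Rightarrow> 'a::field \<Rightarrow> 'a" where
  "abs_trace m x = (\<Sum>j<m. x ^ (3 ^ j))"

definition rel_trace :: "nat \<Rightarrow> nat \<Rightarrow> 'a::field \<Rightarrow> 'a" where
  "rel_trace q n x = (\<Sum>i<n. x ^ (q ^ i))"

text \<open>An element t of the prime field F_3 (inside a field of characteristic 3),
  read as an exponent in {0,1,2}.\<close>
definition f3_val :: "'a::field \<Rightarrow> nat" where
  "f3_val t = (THE k. k < 3 \<and> of_nat k = t)"

definition add_char :: "('a::field \<Rightarrow> 'a) \<Rightarrow> 'a \<Rightarrow> complex" where
  "add_char T c = omega3 ^ f3_val (T c)"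

text \<open>Kloosterman sum over a finite field A with trace map T; note that
  in Isabelle inverse 0 = 0, matching a/x = a x^(Q-2).\<close>
definition kloost :: "'a::field set \<Rightarrow> ('a \<Rightarrow> 'a) \<Rightarrow> 'a \<Rightarrow> complex" where
  "kloost A T a = (\<Sum>x\<in>A. add_char T (x + a / x))"

definition three_pow_dvd :: "nat \<Rightarrow> complex \<Rightarrow> bool" where
  "three_pow_dvd k z \<longleftrightarrow> (\<exists>u v :: int. z = 3 ^ k * (of_int u + of_int v * omega3))"

definition val3 :: "nat \<Rightarrow> complex \<Rightarrow> nat" where
  "val3 d z = (if z = 0 then d else (GREATEST k. three_pow_dvd k z))"

text \<open>Inside a field 'a of order q^n (q = 3^m), F_q is {x. x^q = x}.\<close>
definition Fq :: "nat \<Rightarrow> 'a::field set" where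
  "Fq q = {x. x ^ q = x}"

definition K_base :: "nat \<Rightarrow> 'a::field \<Rightarrow> complex" where
  "K_base m a = kloost (Fq (3 ^ m)) (abs_trace m) a"

definition K_ext :: "nat \<Rightarrow> nat \<Rightarrow> 'a::field \<Rightarrow> complex" where
  "K_ext m n a = kloost UNIV (\<lambda>b. abs_trace m (rel_trace (3 ^ m) n b)) a"

definition H_base :: "nat \<Rightarrow> 'a::field \<Rightarrow> nat" where
  "H_base m a = val3 m (K_base m a)"

definition H_ext :: "nat \<Rightarrow> nat \<Rightarrow> 'a::field \<Rightarrow> nat" where
  "H_ext m n a = val3 (m * n) (K_ext m n a)"

end

theory Submission
  imports Defs "HOL-Computational_Algebra.Computational_Algebra"
begin

text \<open>Assign to a monic \<open>f\<close> over \<open>F\<^sub>q\<close> with nonzero roots \<open>x\<^sub>i\<close> the weight \<open>e(\<Sum>(x\<^sub>i + a / x\<^sub>i))\<close>, which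
  depends only on the two highest and the two lowest coefficients. The resulting L-function is the
  polynomial \<open>1 + (K(a) - 1) T + q T^2 = (1 - \<alpha> T) (1 - \<beta> T)\<close>, and comparing it with its Euler product
  gives \<open>1 - K\<^sub>n(a) = \<alpha>^n + \<beta>^n\<close>. Hence \<open>q^n + K\<^sub>n(a) = (1 - \<alpha>^n) (1 - \<beta>^n)\<close>. As \<open>3\<close> divides \<open>K(a)\<close>, one of
  \<open>\<alpha>, \<beta>\<close> is a 3-adic unit congruent to 1 and the other is divisible by 3, so lifting the exponent
  shows that the 3-adic valuation of \<open>q^n + K\<^sub>n(a)\<close> exceeds that of \<open>q + K(a)\<close> by \<open>h\<close>. Finally
  \<open>|K(a)| < q\<close>, so the valuation of \<open>q + K(a)\<close> is \<open>H(a)\<close>, also when \<open>K(a) = 0\<close>; likewise for \<open>K\<^sub>n(a)\<close>.\<close>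

subsection \<open>Monic polynomials over a subfield\<close>

text \<open>The subfield is a subset of the ambient field, so that polynomials over it and their
  conjugate roots live in one type; coefficients in \<open>F\<close> become a predicate.\<close>

locale subfield =
  fixes F :: "'a::field set"
  assumes zero_mem [simp]: "0 \<in> F"
    and one_mem [simp]: "1 \<in> F"
    and add_mem: "x \<in> F \<Longrightarrow> y \<in> F \<Longrightarrow> x + y \<in> F"
    and uminus_mem: "x \<in> F \<Longrightarrow> - x \<in> F"
    and mult_mem: "x \<in> F \<Longrightarrow> y \<in> F \<Longrightarrow> x * y \<in> F"
    and inverse_mem: "x \<in> F \<Longrightarrow> inverse x \<in> F"
begin

lemma diff_mem: "x \<in> F \<Longrightarrow> y \<in> F \<Longrightarrow> x - y \<in> F"
  using add_mem[of x "- y"] uminus_mem by simp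

lemma divide_mem: "x \<in> F \<Longrightarrow> y \<in> F \<Longrightarrow> x / y \<in> F"
  using mult_mem[of x "inverse y"] inverse_mem by (simp add: divide_inverse)

lemma sum_mem: "(\<And>i. i \<in> A \<Longrightarrow> f i \<in> F) \<Longrightarrow> sum f A \<in> F"
  by (induction A rule: infinite_finite_induct) (auto simp: add_mem)

definition polys :: "'a poly set" where
  "polys = {f. \<forall>i. coeff f i \<in> F}"

lemma coeff_mem: "f \<in> polys \<Longrightarrow> coeff f i \<in> F"
  by (simp add: polys_def)

lemma pCons_polys_iff: "pCons c f \<in> polys \<longleftrightarrow> c \<in> F \<and> f \<in> polys"
  by (auto simp: polys_def coeff_pCons split: nat.splits)

lemma zero_polys [simp]: "0 \<in> polys"
  by (simp add: polys_def)

lemma one_polys [simp]: "1 \<in> polys"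
  by (simp add: one_pCons pCons_polys_iff)

lemma add_polys: "f \<in> polys \<Longrightarrow> g \<in> polys \<Longrightarrow> f + g \<in> polys"
  by (simp add: polys_def add_mem)

lemma diff_polys: "f \<in> polys \<Longrightarrow> g \<in> polys \<Longrightarrow> f - g \<in> polys"
  by (simp add: polys_def diff_mem)

lemma smult_polys: "c \<in> F \<Longrightarrow> f \<in> polys \<Longrightarrow> smult c f \<in> polys"
  by (simp add: polys_def mult_mem)

lemma mult_polys: "f \<in> polys \<Longrightarrow> g \<in> polys \<Longrightarrow> f * g \<in> polys"
  by (auto simp: polys_def coeff_mult intro!: sum_mem mult_mem)

lemma div_mod_polys:
  assumes "f \<in> polys" "g \<in> polys"
  shows "f div g \<in> polys \<and> f mod g \<in> polys"
  using assms(1)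
proof (induction f)
  case (pCons c f)
  then have "pCons c (f mod g) \<in> polys" and "f div g \<in> polys" and "f mod g \<in> polys" and "c \<in> F"
    by (auto simp: pCons_polys_iff)
  then show ?case
    using assms(2) pCons.prems
    by (simp add: div_pCons_eq mod_pCons_eq pCons_polys_iff)
      (auto intro!: divide_mem coeff_mem diff_polys smult_polys pCons_polys_iff[THEN iffD2])
qed auto

definition monics :: "nat \<Rightarrow> 'a poly set" where
  "monics d = {f \<in> polys. lead_coeff f = 1 \<and> degree f = d}"

lemma monics_polys: "f \<in> monics d \<Longrightarrow> f \<in> polys"
  by (simp add: monics_def)

lemma monics_nonzero: "f \<in> monics d \<Longrightarrow> f \<noteq> 0"
  by (auto simp: monics_def)

lemma monics_0: "monics 0 = {1}"
proof -
  have "f = 1" if "f \<in> monics 0" for f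
    using that by (auto simp: monics_def elim!: degree_eq_zeroE)
  then show ?thesis by (auto simp: monics_def)
qed

lemma monics_Suc: "monics (Suc d) = (\<lambda>(c, f). pCons c f) ` (F \<times> monics d)"
proof (intro equalityI subsetI)
  fix f assume f: "f \<in> monics (Suc d)"
  obtain c g where fg: "f = pCons c g" by (cases f)
  have "g \<noteq> 0" using f by (auto simp: monics_def fg)
  then have "c \<in> F \<and> g \<in> monics d"
    using f by (auto simp: monics_def fg pCons_polys_iff)
  then show "f \<in> (\<lambda>(c, f). pCons c f) ` (F \<times> monics d)"
    using fg by auto
next
  fix f assume "f \<in> (\<lambda>(c, f). pCons c f) ` (F \<times> monics d)"
  then obtain c g where "f = pCons c g" "c \<in> F" "g \<in> monics d" by auto
  then show "f \<in> monics (Suc d)"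
    using monics_nonzero[of g d] by (auto simp: monics_def pCons_polys_iff)
qed

lemma card_monics: "card (monics d) = card F ^ d"
proof (induction d)
  case (Suc d)
  have "inj_on (\<lambda>(c, f). pCons c f) (F \<times> monics d)" by (auto simp: inj_on_def)
  then show ?case
    by (simp add: monics_Suc card_image card_cartesian_product Suc)
qed (simp add: monics_0)

lemma finite_monics: "finite F \<Longrightarrow> finite (monics d)"
  by (induction d) (auto simp: monics_0 monics_Suc)

lemma mult_monics: "f \<in> monics d \<Longrightarrow> g \<in> monics e \<Longrightarrow> f * g \<in> monics (d + e)"
  using monics_nonzero[of f d] monics_nonzero[of g e]
  by (auto simp: monics_def mult_polys lead_coeff_mult degree_mult_eq simp del: coeff_mult)

lemma power_monics: "f \<in> monics d \<Longrightarrow> f ^ k \<in> monics (k * d)"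
  by (induction k) (auto simp: monics_0 intro: mult_monics)

lemma monics_dvdE:
  assumes "f \<in> monics d" "g \<in> monics e" "g dvd f"
  obtains h where "h \<in> monics (d - e)" "f = g * h" "e \<le> d"
proof -
  define h where "h = f div g"
  have f: "f = g * h" using assms(3) by (simp add: h_def)
  have "h \<in> polys" using assms div_mod_polys by (auto simp: h_def monics_def)
  moreover have "f \<noteq> 0" using assms(1) monics_nonzero by blast
  then have "g \<noteq> 0" "h \<noteq> 0" using f by auto
  then have "degree f = degree g + degree h" "lead_coeff f = lead_coeff g * lead_coeff h"
    using f degree_mult_eq lead_coeff_mult by auto
  ultimately have "h \<in> monics (d - e)" "e \<le> d"
    using assms by (auto simp: monics_def)
  then show thesis using that f by blast
qed

text \<open>Irreducibility is relative to \<open>F\<close>: only monic divisors with coefficients in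
  \<open>F\<close> are tested, since such a polynomial may split in the ambient field.\<close>

definition irreds :: "'a poly set" where
  "irreds = {P. 0 < degree P \<and> P \<in> monics (degree P) \<and>
     (\<forall>e. \<forall>g \<in> monics e. g dvd P \<longrightarrow> g = 1 \<or> g = P)}"

lemma irreds_monics: "P \<in> irreds \<Longrightarrow> P \<in> monics (degree P)"
  and irreds_degree: "P \<in> irreds \<Longrightarrow> 0 < degree P"
  and irreds_dvd: "P \<in> irreds \<Longrightarrow> g \<in> monics e \<Longrightarrow> g dvd P \<Longrightarrow> g = 1 \<or> g = P"
  by (auto simp: irreds_def)

lemma irreds_polys: "P \<in> irreds \<Longrightarrow> P \<in> polys"
  using irreds_monics monics_polys by blast

lemma irreds_dvd_irreds: "P \<in> irreds \<Longrightarrow> Q \<in> irreds \<Longrightarrow> P dvd Q \<Longrightarrow> P = Q"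
  using irreds_dvd[OF _ irreds_monics, of Q P] irreds_degree[of P] by auto

lemma normalize_monics:
  assumes "f \<in> polys" "f \<noteq> 0"
  shows "smult (inverse (lead_coeff f)) f \<in> monics (degree f)"
  using assms by (auto simp: monics_def intro!: smult_polys inverse_mem coeff_mem)

text \<open>The ideal of \<open>F[X]\<close> generated by \<open>P\<close> and \<open>c\<close> is
  generated by a nonzero element of least degree. Made monic, it divides \<open>P\<close>, so it is
  \<open>1\<close> or \<open>P\<close>; the latter would divide \<open>c\<close>.\<close>

lemma irreds_bezout:
  assumes P: "P \<in> irreds" and c: "c \<in> polys" and ndvd: "\<not> P dvd c"
  obtains u v where "u * P + v * c = 1"
proof -
  define I where "I = {u * P + v * c |u v. u \<in> polys \<and> v \<in> polys}"
  have I_polys: "f \<in> polys" if "f \<in> I" for f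
    using that P c by (auto simp: I_def intro!: add_polys mult_polys irreds_polys[OF P])
  have I_mult: "w * f \<in> I" if f: "f \<in> I" and w: "w \<in> polys" for f w
  proof -
    obtain u v where "f = u * P + v * c" "u \<in> polys" "v \<in> polys"
      using f by (auto simp: I_def)
    then have "w * f = (w * u) * P + (w * v) * c" "w * u \<in> polys" "w * v \<in> polys"
      using w by (auto simp: algebra_simps mult_polys)
    then show ?thesis unfolding I_def by blast
  qed
  have I_diff: "f - g \<in> I" if f: "f \<in> I" and g: "g \<in> I" for f g
  proof -
    obtain u v where "f = u * P + v * c" "u \<in> polys" "v \<in> polys"
      using f by (auto simp: I_def)
    moreover obtain u' v' where "g = u' * P + v' * c" "u' \<in> polys" "v' \<in> polys"
      using g by (auto simp: I_def)
    ultimately have "f - g = (u - u') * P + (v - v') * c" "u - u' \<in> polys" "v - v' \<in> polys"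
      by (auto simp: algebra_simps diff_polys)
    then show ?thesis unfolding I_def by blast
  qed
  have PI: "P \<in> I"
    unfolding I_def by (rule CollectI, rule exI[of _ 1], rule exI[of _ 0]) simp
  have cI: "c \<in> I"
    unfolding I_def by (rule CollectI, rule exI[of _ 0], rule exI[of _ 1]) simp
  have "P \<noteq> 0" using irreds_degree[OF P] by auto
  then obtain g where g: "g \<in> I" "g \<noteq> 0"
    and least: "\<And>f. f \<in> I \<Longrightarrow> f \<noteq> 0 \<Longrightarrow> degree g \<le> degree f"
    using ex_has_least_nat[of "\<lambda>f. f \<in> I \<and> f \<noteq> 0" P degree] PI by blast
  have dvd: "g dvd f" if f: "f \<in> I" for f
  proof -
    have "f mod g = f - (f div g) * g" by (simp add: minus_div_mult_eq_mod)
    then have "f mod g \<in> I"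
      using I_diff[OF f I_mult[OF g(1)]] div_mod_polys I_polys f g by metis
    then show ?thesis
      using least[of "f mod g"] degree_mod_less[OF g(2), of f] by fastforce
  qed
  define g' where "g' = smult (inverse (lead_coeff g)) g"
  have g': "g' \<in> monics (degree g)"
    unfolding g'_def by (rule normalize_monics[OF I_polys[OF g(1)] g(2)])
  have g'_dvd: "g' dvd f" if "f \<in> I" for f
    using dvd[OF that] g(2) by (simp add: g'_def smult_dvd_iff)
  have "g' = 1"
    using irreds_dvd[OF P g' g'_dvd[OF PI]] g'_dvd[OF cI] ndvd by auto
  moreover have "[:inverse (lead_coeff g):] * g \<in> I"
    using g by (intro I_mult) (auto simp: pCons_polys_iff intro!: inverse_mem coeff_mem I_polys)
  ultimately have "1 \<in> I" by (simp add: g'_def)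
  then show thesis using that by (auto simp: I_def)
qed

lemma irreds_prime:
  assumes "P \<in> irreds" "f \<in> polys" "P dvd f * g"
  shows "P dvd f \<or> P dvd g"
proof (rule ccontr)
  assume *: "\<not> ?thesis"
  then obtain u v where "u * P + v * f = 1"
    using irreds_bezout[OF assms(1,2)] by metis
  then have "g = (u * P + v * f) * g" by simp
  also have "\<dots> = P * (u * g) + v * (f * g)" by (simp add: algebra_simps)
  finally have g: "g = P * (u * g) + v * (f * g)" .
  have "P dvd g" by (subst g) (intro dvd_add dvd_mult dvd_triv_left assms(3))
  then show False using * by simp
qed

text \<open>The minimal polynomial of \<open>x\<close> over \<open>F\<close>: in any factorization
  one factor vanishes at \<open>x\<close>, and by minimality that factor has full degree.\<close>

lemma ex_irred_root:
  assumes "f \<in> monics d" "poly f x = 0"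
  shows "\<exists>P \<in> irreds. poly P x = 0"
proof -
  obtain P where P: "P \<in> monics (degree P)" "poly P x = 0"
    and least: "\<And>g. g \<in> monics (degree g) \<Longrightarrow> poly g x = 0 \<Longrightarrow> degree P \<le> degree g"
    using ex_has_least_nat[of "\<lambda>f. f \<in> monics (degree f) \<and> poly f x = 0" f degree] assms
    by (auto simp: monics_def)
  have "degree P \<noteq> 0"
    using P monics_0 by (metis poly_1 singletonD zero_neq_one)
  moreover have "g = 1 \<or> g = P" if g: "g \<in> monics e" and dvd: "g dvd P" for e g
  proof -
    obtain h where h: "h \<in> monics (degree P - e)" "P = g * h" "e \<le> degree P"
      using monics_dvdE[OF P(1) g dvd] by blast
    have deg: "degree g = e" "degree h = degree P - e" using g h by (auto simp: monics_def)
    consider "poly g x = 0" | "poly h x = 0" using P(2) h(2) by auto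
    then show ?thesis
    proof cases
      case 1
      then have "degree P - e = 0" using least[of g] g deg by auto
      then show ?thesis using h monics_0 by auto
    next
      case 2
      then have "e = 0" using least[of h] h deg \<open>degree P \<noteq> 0\<close> by auto
      then show ?thesis using g monics_0 by auto
    qed
  qed
  ultimately show ?thesis using P by (auto simp: irreds_def)
qed

lemma ex_irred_factor:
  assumes "f \<in> monics d" "0 < d"
  shows "\<exists>P \<in> irreds. P dvd f"
proof -
  have "f dvd f \<and> f \<in> monics (degree f) \<and> 0 < degree f"
    using assms by (auto simp: monics_def)
  then obtain P where P: "P dvd f" "P \<in> monics (degree P)" "0 < degree P"
    and least: "\<And>g. g dvd f \<Longrightarrow> g \<in> monics (degree g) \<Longrightarrow> 0 < degree g \<Longrightarrow> degree P \<le> degree g"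
    using ex_has_least_nat[of "\<lambda>g. g dvd f \<and> g \<in> monics (degree g) \<and> 0 < degree g" f degree]
    by blast
  have "g = 1 \<or> g = P" if g: "g \<in> monics e" and dvd: "g dvd P" for e g
  proof (cases "e = 0")
    case True
    then show ?thesis using g monics_0 by auto
  next
    case False
    obtain h where h: "h \<in> monics (degree P - e)" "P = g * h" "e \<le> degree P"
      using monics_dvdE[OF P(2) g dvd] by blast
    have "degree g = e" using g by (auto simp: monics_def)
    then have "degree P \<le> e"
      using least[of g] g False dvd P(1) dvd_trans by blast
    then show ?thesis using h monics_0 by auto
  qed
  then show ?thesis using P by (auto simp: irreds_def)
qed

section \<open>Prime power divisors and the Euler product\<close>

definition primepow_divisors :: "'a poly \<Rightarrow> ('a poly \<times> nat) set" where
  "primepow_divisors f = {(P, k). P \<in> irreds \<and> 0 < k \<and> P ^ k dvd f}"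

lemma irreds_power_dvd_mult:
  assumes P: "P \<in> irreds" and Q: "Q \<in> irreds" and "P \<noteq> Q" and "P ^ k dvd Q * g"
  shows "P ^ k dvd g"
  using assms(4)
proof (induction k)
  case (Suc k)
  have "P ^ k dvd Q * g"
    by (rule dvd_trans[OF le_imp_power_dvd Suc.prems]) simp
  then have "P ^ k dvd g" by (rule Suc.IH)
  then obtain h where h: "g = P ^ k * h" by (elim dvdE)
  have "P ^ k * P dvd P ^ k * (Q * h)" using Suc.prems h by (simp add: ac_simps)
  moreover have "P ^ k \<noteq> 0" using irreds_degree[OF P] by auto
  ultimately have "P dvd Q * h" by (simp only: dvd_mult_cancel_left) simp
  then have "P dvd h" using irreds_prime[OF P irreds_polys[OF Q]] irreds_dvd_irreds[OF P Q] assms(3) by blast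
  then have "P * P ^ k dvd h * P ^ k" by (intro mult_dvd_mono dvd_refl)
  then show ?case by (simp only: h power_Suc mult.commute[of h])
qed auto

lemma primepow_divisors_mult:
  assumes Q: "Q \<in> irreds"
  shows "primepow_divisors (Q * g) =
    insert (Q, 1) ((\<lambda>(P, k). (P, if P = Q then Suc k else k)) ` primepow_divisors g)"
    (is "?L = insert _ (?s ` _)")
proof (rule set_eqI)
  fix p :: "'a poly \<times> nat"
  obtain P k where p: "p = (P, k)" by (cases p)
  have "Q \<noteq> 0" using irreds_degree[OF Q] by auto
  show "p \<in> ?L \<longleftrightarrow> p \<in> insert (Q, 1) (?s ` primepow_divisors g)"
  proof (cases "P = Q")
    case True
    have "p \<in> ?s ` primepow_divisors g \<longleftrightarrow> (\<exists>l. k = Suc l \<and> (Q, l) \<in> primepow_divisors g)"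
    proof
      assume "p \<in> ?s ` primepow_divisors g"
      then show "\<exists>l. k = Suc l \<and> (Q, l) \<in> primepow_divisors g"
        by (clarsimp simp: p True split: if_splits)
    next
      assume "\<exists>l. k = Suc l \<and> (Q, l) \<in> primepow_divisors g"
      then obtain l where "(Q, l) \<in> primepow_divisors g" "p = ?s (Q, l)"
        by (auto simp: p True)
      then show "p \<in> ?s ` primepow_divisors g" by (rule rev_image_eqI)
    qed
    also have "\<dots> \<longleftrightarrow> (\<exists>l. k = Suc l \<and> 0 < l \<and> Q ^ l dvd g)"
      using Q by (simp add: primepow_divisors_def)
    finally have img: "p \<in> ?s ` primepow_divisors g \<longleftrightarrow> (\<exists>l. k = Suc l \<and> 0 < l \<and> Q ^ l dvd g)" .
    have "Q ^ Suc l dvd Q * g \<longleftrightarrow> Q ^ l dvd g" for l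
      using \<open>Q \<noteq> 0\<close> by (simp only: power_Suc dvd_mult_cancel_left) simp
    then have "p \<in> ?L \<longleftrightarrow> (\<exists>l. k = Suc l \<and> Q ^ l dvd g)"
      using Q by (cases k) (simp_all add: primepow_divisors_def p True del: power_Suc)
    also have "\<dots> \<longleftrightarrow> k = 1 \<or> (\<exists>l. k = Suc l \<and> 0 < l \<and> Q ^ l dvd g)"
      by (cases "k = 1") auto
    finally show ?thesis unfolding insert_iff img by (simp add: p True)
  next
    case False
    have img: "p \<in> ?s ` primepow_divisors g \<longleftrightarrow> p \<in> primepow_divisors g"
    proof
      assume "p \<in> ?s ` primepow_divisors g"
      then show "p \<in> primepow_divisors g"
        using False by (clarsimp simp: p split: if_splits)
    next
      assume "p \<in> primepow_divisors g"
      moreover have "p = ?s p" using False by (simp add: p)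
      ultimately show "p \<in> ?s ` primepow_divisors g" by (rule rev_image_eqI)
    qed
    have "P ^ k dvd Q * g \<longleftrightarrow> P ^ k dvd g" if "P \<in> irreds"
      by (rule iffI, rule irreds_power_dvd_mult[OF that Q False], assumption, rule dvd_mult)
    then have "p \<in> ?L \<longleftrightarrow> p \<in> primepow_divisors g"
      unfolding primepow_divisors_def p mem_Collect_eq case_prod_conv by meson
    then show ?thesis unfolding insert_iff img using False by (simp add: p)
  qed
qed

text \<open>\<open>P\<close> occurs once for each exponent up to its multiplicity in
  \<open>f\<close>, so this is the degree form of unique factorization. Removing one irreducible
  factor \<open>Q\<close> lowers both sides by \<open>degree Q\<close>.\<close>

lemma degree_eq_sum_primepow_divisors:
  assumes "f \<in> monics d"
  shows "finite (primepow_divisors f) \<and> d = (\<Sum>(P, k) \<in> primepow_divisors f. degree P)"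
  using assms
proof (induction d arbitrary: f rule: less_induct)
  case (less d)
  show ?case
  proof (cases "d = 0")
    case True
    have "primepow_divisors 1 = {}"
    proof -
      have False if "P \<in> irreds" "0 < k" "P ^ k dvd 1" for P k
      proof -
        have "P dvd 1" using that(2,3) by (simp add: is_unit_power_iff)
        then show False using irreds_degree[OF that(1)] dvd_imp_degree_le[of P 1] by simp
      qed
      then show ?thesis by (auto simp: primepow_divisors_def)
    qed
    moreover have "f = 1" using True less.prems monics_0 by auto
    ultimately show ?thesis using True by simp
  next
    case False
    obtain Q where Q: "Q \<in> irreds" "Q dvd f" using ex_irred_factor less.prems False by blast
    obtain g where g: "g \<in> monics (d - degree Q)" "f = Q * g" "degree Q \<le> d"
      using monics_dvdE[OF less.prems irreds_monics[OF Q(1)] Q(2)] by blast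
    let ?s = "\<lambda>(P, k). (P, if P = Q then Suc k else k)"
    have IH: "finite (primepow_divisors g)"
        "d - degree Q = (\<Sum>(P, k) \<in> primepow_divisors g. degree P)"
      using less.IH[OF _ g(1)] irreds_degree[OF Q(1)] False by auto
    have "inj_on ?s (primepow_divisors g)" by (auto simp: inj_on_def split: if_splits)
    then have "(\<Sum>(P, k) \<in> ?s ` primepow_divisors g. degree P) = d - degree Q"
      unfolding IH(2) by (subst sum.reindex) (auto intro!: sum.cong)
    \<comment> \<open>Exponents in \<open>primepow_divisors g\<close> are positive, so the shifted
      pairs at \<open>Q\<close> have exponent at least 2.\<close>
    moreover have "(Q, 1) \<notin> ?s ` primepow_divisors g"
      by (auto simp: primepow_divisors_def)
    ultimately show ?thesis
      using IH(1) g(3) by (auto simp: g(2) primepow_divisors_mult[OF Q(1)])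
  qed
qed

text \<open>Together with the weight \<open>degree P\<close>, this encodes the von Mangoldt function
  of \<open>F[X]\<close> in degree \<open>j\<close>.\<close>

definition primepows :: "nat \<Rightarrow> ('a poly \<times> nat) set" where
  "primepows j = {(P, k). P \<in> irreds \<and> 0 < k \<and> k * degree P = j}"

lemma primepows_monics: "(P, k) \<in> primepows j \<Longrightarrow> P ^ k \<in> monics j"
  using power_monics[OF irreds_monics] by (auto simp: primepows_def)

lemma finite_primepows:
  assumes "finite F" "0 < j"
  shows "finite (primepows j)"
proof (rule finite_subset)
  show "primepows j \<subseteq> (\<Union>d \<in> {..j}. monics d) \<times> {..j}"
  proof safe
    fix P k assume "(P, k) \<in> primepows j"
    then have "P \<in> irreds" and j: "j = k * degree P" and k: "0 < k"
      by (auto simp: primepows_def)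
    then show "P \<in> (\<Union>d \<in> {..j}. monics d)"
      using irreds_monics by (auto intro!: bexI[of _ "degree P"])
    show "k \<le> j" using irreds_degree[OF \<open>P \<in> irreds\<close>] j by simp
  qed
qed (use assms finite_monics in auto)

text \<open>The logarithmic derivative of the Euler product
  \<open>\<Sum>\<^sub>f lam f T^(degree f) = \<Prod>\<^sub>P (1 - lam P T^(degree P))^(-1)\<close>, compared coefficientwise.\<close>

lemma euler_product_convolution:
  fixes lam :: "'a poly \<Rightarrow> 'c::comm_ring_1"
  assumes fin: "finite F"
    and lam: "\<And>f g d e. f \<in> monics d \<Longrightarrow> g \<in> monics e \<Longrightarrow> lam (f * g) = lam f * lam g"
  shows "of_nat d * (\<Sum>f \<in> monics d. lam f) =
    (\<Sum>j = 1..d. (\<Sum>(P, k) \<in> primepows j. of_nat (degree P) * lam (P ^ k)) *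
      (\<Sum>g \<in> monics (d - j). lam g))"
proof -
  let ?X = "Sigma (monics d) primepow_divisors"
  let ?Y = "Sigma {1..d} (\<lambda>j. primepows j \<times> monics (d - j))"
  have "of_nat d * (\<Sum>f \<in> monics d. lam f) = (\<Sum>f \<in> monics d. of_nat d * lam f)"
    by (simp add: sum_distrib_left)
  also have "\<dots> = (\<Sum>f \<in> monics d. \<Sum>(P, k) \<in> primepow_divisors f. of_nat (degree P) * lam f)"
  proof (intro sum.cong refl)
    fix f assume "f \<in> monics d"
    then have "of_nat d = (\<Sum>(P, k) \<in> primepow_divisors f. of_nat (degree P) :: 'c)"
      using degree_eq_sum_primepow_divisors[of f d] by (simp add: case_prod_beta)
    then show "of_nat d * lam f = (\<Sum>(P, k) \<in> primepow_divisors f. of_nat (degree P) * lam f)"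
      by (simp add: sum_distrib_right case_prod_beta)
  qed
  also have "\<dots> = (\<Sum>(f, P, k) \<in> ?X. of_nat (degree P) * lam f)"
    using finite_monics[OF fin] degree_eq_sum_primepow_divisors
    by (subst sum.Sigma) (auto simp: case_prod_beta)
  \<comment> \<open>Factor \<open>f = P ^ k * g\<close> and sort by the degree \<open>j\<close> of
    \<open>P ^ k\<close>.\<close>
  also have "\<dots> = (\<Sum>(j, (P, k), g) \<in> ?Y. of_nat (degree P) * lam (P ^ k) * lam g)"
  proof (rule sum.reindex_bij_witness[of _ "\<lambda>(j, (P, k), g). (P ^ k * g, P, k)"
        "\<lambda>(f, P, k). (k * degree P, (P, k), f div P ^ k)"], goal_cases)
    case (1 x)
    then show ?case by (auto simp: primepow_divisors_def)
  next
    case (2 x)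
    then obtain f P k where x: "x = (f, P, k)" and f: "f \<in> monics d"
      and P: "P \<in> irreds" "0 < k" "P ^ k dvd f"
      by (auto simp: primepow_divisors_def)
    from P have pk: "(P, k) \<in> primepows (k * degree P)" by (auto simp: primepows_def)
    obtain h where h: "h \<in> monics (d - k * degree P)" "f = P ^ k * h" "k * degree P \<le> d"
      using monics_dvdE[OF f primepows_monics[OF pk] P(3)] by blast
    have "P \<noteq> 0" using irreds_degree[OF P(1)] by auto
    then show ?case using h pk P irreds_degree[OF P(1)] by (auto simp: x)
  next
    case (3 y)
    then obtain j P k g where y: "y = (j, (P, k), g)" and P: "P \<in> irreds" "k * degree P = j"
      by (auto simp: primepows_def)
    have "P \<noteq> 0" using irreds_degree[OF P(1)] by auto
    then show ?case using P by (auto simp: y)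
  next
    case (4 y)
    then obtain j P k g where y: "y = (j, (P, k), g)" and j: "j \<in> {1..d}"
      and pk: "(P, k) \<in> primepows j" and g: "g \<in> monics (d - j)"
      by auto
    then show ?case
      using mult_monics[OF primepows_monics[OF pk] g] by (auto simp: primepow_divisors_def primepows_def)
  next
    case (5 x)
    then obtain f P k where x: "x = (f, P, k)" and f: "f \<in> monics d"
      and P: "P \<in> irreds" "0 < k" "P ^ k dvd f"
      by (auto simp: primepow_divisors_def)
    from P have pk: "(P, k) \<in> primepows (k * degree P)" by (auto simp: primepows_def)
    obtain h where h: "h \<in> monics (d - k * degree P)" "f = P ^ k * h" "k * degree P \<le> d"
      using monics_dvdE[OF f primepows_monics[OF pk] P(3)] by blast
    have "P \<noteq> 0" using irreds_degree[OF P(1)] by auto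
    then show ?case using lam[OF primepows_monics[OF pk] h(1)] h by (simp add: x mult.assoc)
  qed
  also have "\<dots> = (\<Sum>j = 1..d. \<Sum>(P, k) \<in> primepows j. \<Sum>g \<in> monics (d - j).
      of_nat (degree P) * lam (P ^ k) * lam g)"
    using finite_monics[OF fin] finite_primepows[OF fin]
    by (subst sum.Sigma[symmetric])
      (auto simp: sum.cartesian_product case_prod_beta intro!: sum.cong)
  also have "\<dots> = (\<Sum>j = 1..d. (\<Sum>(P, k) \<in> primepows j. of_nat (degree P) * lam (P ^ k)) *
      (\<Sum>g \<in> monics (d - j). lam g))"
    by (simp add: sum_product case_prod_beta)
  finally show ?thesis .
qed

text \<open>The Euler product for the constant weight 1, where the sums over monic polynomials are
  powers of \<open>card F\<close>; induction isolates the term \<open>j = d\<close>. Later it turns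
  a root bound for each prime power into an equality.\<close>

lemma sum_degree_primepows:
  assumes fin: "finite F" and "0 < j"
  shows "(\<Sum>(P, k) \<in> primepows j. degree P) = card F ^ j"
  using assms(2)
proof (induction j rule: less_induct)
  case (less d)
  define V where "V = (\<lambda>j. \<Sum>(P, k) \<in> primepows j. int (degree P))"
  define q where "q = int (card F)"
  have "int d * q ^ d = (\<Sum>j = 1..d. V j * q ^ (d - j))"
    using euler_product_convolution[OF fin, of "\<lambda>_. 1 :: int" d]
    by (simp add: card_monics V_def q_def)
  also have "\<dots> = V d + (\<Sum>j \<in> {1..<d}. V j * q ^ (d - j))"
    using less.prems by (subst atLeastLessThanSuc_atLeastAtMost[symmetric]) (simp add: sum.atLeastLessThan_Suc)
  also have "(\<Sum>j \<in> {1..<d}. V j * q ^ (d - j)) = (\<Sum>j \<in> {1..<d}. q ^ d)"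
  proof (intro sum.cong refl)
    fix j assume j: "j \<in> {1..<d}"
    have "V j = int (\<Sum>(P, k) \<in> primepows j. degree P)"
      unfolding V_def by (simp add: case_prod_beta)
    moreover have "(\<Sum>(P, k) \<in> primepows j. degree P) = card F ^ j" using less.IH[of j] j by simp
    ultimately have "V j = q ^ j" by (simp only: q_def of_nat_power)
    then show "V j * q ^ (d - j) = q ^ d" using j by (simp flip: power_add)
  qed
  finally have "V d = q ^ d" using less.prems by (simp add: algebra_simps of_nat_diff)
  moreover have "V d = int (\<Sum>(P, k) \<in> primepows d. degree P)"
    unfolding V_def by (simp add: case_prod_beta)
  ultimately show ?case unfolding q_def by (metis of_nat_eq_iff of_nat_power)
qed

end

section \<open>Counting in finite fields\<close>

lemma power_card_UNIV:
  fixes x :: "'a::{field, finite}"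
  shows "x ^ card (UNIV :: 'a set) = x"
proof (cases "x = 0")
  case False
  let ?U = "UNIV - {0 :: 'a}"
  have "prod (\<lambda>y. y) ?U = (\<Prod>y\<in>?U. x * y)"
    by (rule prod.reindex_bij_witness[of _ "\<lambda>y. x * y" "\<lambda>y. y / x"]) (use False in auto)
  also have "\<dots> = x ^ card ?U * prod (\<lambda>y. y) ?U" by (simp add: prod.distrib)
  finally have "x ^ card ?U = 1" by simp
  moreover have "card (UNIV :: 'a set) = Suc (card ?U)"
    by (rule card.remove) auto
  ultimately show ?thesis by (metis power_Suc mult.right_neutral)
qed (simp add: finite_UNIV_card_ge_0)

lemma of_nat_card_UNIV: "of_nat (card (UNIV :: 'a set)) = (0 :: 'a::{ring_1, finite})"
proof -
  have "(\<Sum>x\<in>(UNIV :: 'a set). x) = (\<Sum>x\<in>UNIV. x + 1)"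
    by (rule sum.reindex_bij_witness[of _ "\<lambda>x. x + 1" "\<lambda>x. x - 1"]) auto
  then show ?thesis by (simp add: sum.distrib)
qed

text \<open>Covers both traces: \<open>b = 3\<close> for the absolute one, \<open>b = 3 ^ m\<close>
  for the relative one. The fibre is the root set of a nonzero polynomial of degree at most
  \<open>b ^ (k - 1)\<close>.\<close>

lemma card_power_sum_fibre:
  assumes "2 \<le> b" "0 < k"
  shows "finite {x :: 'a::field. (\<Sum>i<k. x ^ (b ^ i)) = c} \<and>
    card {x :: 'a. (\<Sum>i<k. x ^ (b ^ i)) = c} \<le> b ^ (k - 1)"
proof -
  define p :: "'a poly" where "p = (\<Sum>i<k. monom 1 (b ^ i)) - [:c:]"
  have "{x. (\<Sum>i<k. x ^ (b ^ i)) = c} = {x. poly p x = 0}"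
    by (simp add: p_def poly_sum poly_monom)
  moreover have "coeff p (b ^ (k - 1)) = 1"
  proof -
    have "coeff p (b ^ (k - 1)) = (\<Sum>i<k. if i = k - 1 then 1 else 0)"
      unfolding p_def coeff_diff coeff_sum coeff_monom
      using assms by (auto simp: coeff_pCons split: nat.splits)
    then show ?thesis using assms by simp
  qed
  then have "p \<noteq> 0" by auto
  moreover have "degree p \<le> b ^ (k - 1)"
    unfolding p_def
  proof (intro degree_diff_le degree_sum_le)
    fix i assume "i \<in> {..<k}"
    then have "b ^ i \<le> b ^ (k - 1)" using assms by (intro power_increasing) auto
    then show "degree (monom (1 :: 'a) (b ^ i)) \<le> b ^ (k - 1)"
      using degree_monom_le le_trans by blast
  qed auto
  ultimately show ?thesis
    using card_poly_roots_bound[of p] poly_roots_finite[of p] by auto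
qed

subsection \<open>Trace maps and additive characters in characteristic 3\<close>

lemma char3_cube_fixed:
  assumes "(3 :: 'a::field) = 0" "t ^ 3 = (t :: 'a)"
  shows "\<exists>k<3. t = of_nat k"
proof -
  have "t * (t - 1) * (t - 2) = t ^ 3 - t - 3 * (t ^ 2 - t)"
    by (simp add: power2_eq_square power3_eq_cube algebra_simps)
  then have "t * (t - 1) * (t - 2) = 0" using assms by simp
  then consider "t = of_nat 0" | "t = of_nat 1" | "t = of_nat 2" by auto
  then show ?thesis
  proof cases
    case 1 then show ?thesis by (intro exI[of _ 0]) simp
  next
    case 2 then show ?thesis by (intro exI[of _ 1]) simp
  next
    case 3 then show ?thesis by (intro exI[of _ 2]) simp
  qed
qed

lemma CHAR_eq_3:
  assumes "(3 :: 'a::field) = 0"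
  shows "CHAR('a) = 3"
proof -
  have "of_nat 3 = (0 :: 'a)" using assms by simp
  then have "CHAR('a) dvd 3" by (simp only: of_nat_eq_0_iff_char_dvd)
  moreover have "prime (3 :: nat)" by simp
  ultimately show ?thesis using CHAR_not_1'[where ?'a = 'a] by (auto simp: prime_nat_iff)
qed

lemma add_power_3_power:
  assumes "(3 :: 'a::field) = 0"
  shows "(x + y :: 'a) ^ (3 ^ k) = x ^ (3 ^ k) + y ^ (3 ^ k)"
  by (rule freshmans_dream'[of _ k]) (simp_all add: CHAR_eq_3[OF assms])

lemma sum_power_3_power:
  assumes "(3 :: 'a::field) = 0"
  shows "(sum f A :: 'a) ^ (3 ^ k) = (\<Sum>i\<in>A. f i ^ (3 ^ k))"
  by (rule freshmans_dream_sum'[of _ k]) (simp_all add: CHAR_eq_3[OF assms])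

lemma f3_val_of_nat:
  assumes "(3 :: 'a::field) = 0"
  shows "f3_val (of_nat k :: 'a) = k mod 3"
  unfolding f3_val_def
proof (rule the_equality)
  have *: "of_nat i = (of_nat (i mod 3) :: 'a)" for i
    by (subst mod_mult_div_eq[of i 3, symmetric]) (simp only: of_nat_add of_nat_mult of_nat_numeral assms, simp)
  then show "k mod 3 < 3 \<and> of_nat (k mod 3) = (of_nat k :: 'a)" using *[of k] by simp
  fix j assume j: "j < 3 \<and> of_nat j = (of_nat k :: 'a)"
  then have eq: "of_nat j = (of_nat (k mod 3) :: 'a)" using *[of k] by simp
  have aux: "i = l" if "l < 3" "i \<le> l" "of_nat i = (of_nat l :: 'a)" for i l
  proof -
    have "of_nat (l - i) = (0 :: 'a)" using that by (simp add: of_nat_diff)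
    then have "3 dvd l - i" by (simp only: of_nat_eq_0_iff_char_dvd CHAR_eq_3[OF assms])
    then show ?thesis using that by (auto dest: dvd_imp_le)
  qed
  show "j = k mod 3"
  proof (cases "j \<le> k mod 3")
    case True
    then show ?thesis by (intro aux eq) simp
  next
    case False
    then show ?thesis using j by (intro aux[symmetric] eq[symmetric]) auto
  qed
qed

lemma omega3_cube: "omega3 ^ 3 = 1"
  by (simp add: omega3_def DeMoivre)

lemma omega3_neq_1: "omega3 \<noteq> 1"
  by (simp add: omega3_def complex_eq_iff cos_120)

lemma omega3_sum: "1 + omega3 + omega3 ^ 2 = 0"
proof -
  have "(omega3 - 1) * (1 + omega3 + omega3 ^ 2) = omega3 ^ 3 - 1"
    by (simp add: power2_eq_square power3_eq_cube algebra_simps)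
  then show ?thesis using omega3_cube omega3_neq_1 by simp
qed

lemma omega3_power_mod: "omega3 ^ (k mod 3) = omega3 ^ k"
proof -
  have "omega3 ^ k = omega3 ^ (k mod 3 + 3 * (k div 3))" by simp
  also have "\<dots> = omega3 ^ (k mod 3)"
    by (simp only: power_add power_mult omega3_cube power_one mult_1_right)
  finally show ?thesis ..
qed

lemma add_char_of_nat:
  assumes "(3 :: 'a::field) = 0" "T c = (of_nat k :: 'a)"
  shows "add_char T c = omega3 ^ k"
  by (simp add: add_char_def assms(2) f3_val_of_nat[OF assms(1)] omega3_power_mod)

lemma add_char_eq_1_iff:
  assumes "(3 :: 'a::field) = 0" "T c ^ 3 = (T c :: 'a)"
  shows "add_char T c = 1 \<longleftrightarrow> T c = 0"
proof -
  obtain k where k: "k < 3" "T c = of_nat k"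
    using char3_cube_fixed[OF assms] by auto
  have "omega3 ^ 2 \<noteq> 1" using omega3_cube omega3_neq_1 by (auto simp: power3_eq_cube power2_eq_square)
  moreover have "(2 :: 'a) \<noteq> 0" using assms(1) by (metis add_0 numeral_plus_one semiring_norm(5) zero_neq_one)
  moreover have "k = 0 \<or> k = 1 \<or> k = 2" using k(1) by auto
  ultimately show ?thesis
    using omega3_neq_1 by (auto simp: add_char_of_nat[OF assms(1), of T c, OF k(2)] k(2))
qed

lemma add_char_add:
  assumes "(3 :: 'a::field) = 0" "T x ^ 3 = (T x :: 'a)" "T y ^ 3 = T y" "T (x + y) = T x + T y"
  shows "add_char T (x + y) = add_char T x * add_char T y"
proof -
  obtain k l where "T x = of_nat k" "T y = of_nat l"
    using char3_cube_fixed[OF assms(1)] assms(2,3) by metis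
  then show ?thesis
    using assms(4) by (simp add: add_char_of_nat[OF assms(1), of T _ k] add_char_of_nat[OF assms(1), of T _ l]
        add_char_of_nat[OF assms(1), of T _ "k + l"] power_add)
qed

lemma abs_trace_add:
  assumes "(3 :: 'a::field) = 0"
  shows "abs_trace k (x + y :: 'a) = abs_trace k x + abs_trace k y"
  by (simp add: abs_trace_def add_power_3_power[OF assms] sum.distrib)

lemma abs_trace_minus: "abs_trace k (- x :: 'a::field) = - abs_trace k x"
  by (simp add: abs_trace_def power_minus_odd sum_negf)

text \<open>Cubing shifts the summands \<open>x ^ 3 ^ j\<close> by one place, and
  \<open>x ^ 3 ^ M = x\<close> closes the cycle; so the trace takes values in the prime
  field.\<close>

lemma abs_trace_cube:
  assumes "(3 :: 'a::field) = 0" "x \<in> Fq (3 ^ M)"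
  shows "abs_trace M (x :: 'a) ^ 3 = abs_trace M x"
proof -
  have "abs_trace M x ^ (3 ^ 1) = (\<Sum>j<M. x ^ 3 ^ Suc j)"
    unfolding abs_trace_def sum_power_3_power[OF assms(1)] by (simp flip: power_mult add: mult.commute)
  moreover have "x ^ 3 ^ 0 + (\<Sum>j<M. x ^ 3 ^ Suc j) = (\<Sum>j<M. x ^ 3 ^ j) + x ^ 3 ^ M"
    using sum.lessThan_Suc_shift[of "\<lambda>j. x ^ 3 ^ j" M] by simp
  ultimately show ?thesis using assms(2) by (simp add: abs_trace_def Fq_def)
qed

lemma subfield_Fq:
  assumes "(3 :: 'a::field) = 0"
  shows "subfield (Fq (3 ^ M) :: 'a set)"
  by standard (simp_all add: Fq_def add_power_3_power[OF assms] power_minus_odd power_mult_distrib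
      power_inverse zero_power)

text \<open>Instantiated twice in the end, with \<open>F_q\<close> and \<open>M = m\<close> and with
  the whole field and \<open>M = m * n\<close>, so that integrality and size bounds are proved once
  for both Kloosterman sums.\<close>

locale ternary_subfield =
  fixes F :: "'a::field set" and M :: nat
  assumes three_eq_0: "(3 :: 'a) = 0"
    and F_def: "F = Fq (3 ^ M)"
    and card_F: "card F = 3 ^ M"
begin

sublocale subfield F
  unfolding F_def by (rule subfield_Fq[OF three_eq_0])

lemma finite_F: "finite F"
  by (rule card_ge_0_finite) (simp add: card_F)

lemma M_pos: "0 < M"
proof -
  have "card {0, 1 :: 'a} \<le> card F"
    by (intro card_mono finite_F) auto
  then show ?thesis by (cases M) (auto simp: card_F)
qed

lemma card_trace_kernel:
  "finite {x :: 'a. abs_trace M x = c}" "card {x :: 'a. abs_trace M x = c} \<le> 3 ^ (M - 1)"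
  using card_power_sum_fibre[of 3 M c] M_pos by (auto simp: abs_trace_def)

definition echar :: "'a \<Rightarrow> complex" where
  "echar = add_char (abs_trace M)"

lemma echar_add: "x \<in> F \<Longrightarrow> y \<in> F \<Longrightarrow> echar (x + y) = echar x * echar y"
  unfolding echar_def F_def
  by (intro add_char_add abs_trace_cube abs_trace_add three_eq_0)

lemma echar_0: "echar 0 = 1"
  using add_char_of_nat[OF three_eq_0, of "abs_trace M" 0 0]
  by (simp add: echar_def abs_trace_def zero_power)

text \<open>The trace takes each value at most \<open>3 ^ (M - 1)\<close> times, so it cannot vanish
  at all \<open>3 ^ M\<close> elements of \<open>F\<close>.\<close>

lemma echar_nontrivial: "\<exists>t \<in> F. echar t \<noteq> 1"
proof (rule ccontr)
  assume "\<not> ?thesis"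
  then have "F \<subseteq> {x. abs_trace M x = 0}"
    using add_char_eq_1_iff[OF three_eq_0, of "abs_trace M"] abs_trace_cube[OF three_eq_0]
    by (auto simp: echar_def F_def)
  then have "card F \<le> card {x :: 'a. abs_trace M x = 0}"
    by (intro card_mono card_trace_kernel(1))
  also have "\<dots> \<le> 3 ^ (M - 1)" by (rule card_trace_kernel(2))
  finally have "3 ^ M \<le> (3 :: nat) ^ (M - 1)" by (simp only: card_F)
  moreover have "(3 :: nat) ^ (M - 1) < 3 ^ M" using M_pos by (intro power_strict_increasing) auto
  ultimately show False by linarith
qed

section \<open>Kloosterman sums as small integers divisible by 3\<close>

lemma kloosterman_arg_mem: "a \<in> F \<Longrightarrow> x \<in> F \<Longrightarrow> x + a / x \<in> F"
  by (intro add_mem divide_mem)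

text \<open>Replacing \<open>x\<close> by \<open>- x\<close> negates the trace, so the values
  \<open>omega3\<close> and \<open>omega3 ^ 2\<close> occur equally often, \<open>N\<close> times
  each. As these add up to \<open>-1\<close>, the sum is \<open>(3 ^ M - 2 * N) - N\<close>.\<close>

lemma kloosterman_integer:
  assumes a: "a \<in> F"
  defines "N \<equiv> card {x \<in> F. abs_trace M (x + a / x) = 1}"
  shows "K_base M a = of_int (3 ^ M - 3 * int N)" "2 * N \<le> 3 ^ M"
    and "N = 0 \<Longrightarrow> x \<in> F \<Longrightarrow> abs_trace M (x + a / x) = 0"
proof -
  define A where "A k = {x \<in> F. abs_trace M (x + a / x) = of_nat k}" for k
  have fin: "finite (A k)" for k using finite_F by (simp add: A_def)
  have two: "(2 :: 'a) = - 1" using three_eq_0 by (metis eq_neg_iff_add_eq_0 numeral_plus_one semiring_norm(5))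
  have F: "F = A 0 \<union> (A 1 \<union> A 2)"
  proof -
    have "x \<in> A 0 \<union> (A 1 \<union> A 2)" if x: "x \<in> F" for x
    proof -
      obtain k where "k < 3" "abs_trace M (x + a / x) = of_nat k"
        using char3_cube_fixed[OF three_eq_0 abs_trace_cube[OF three_eq_0]]
          kloosterman_arg_mem[OF a x] unfolding F_def by blast
      moreover from this have "k = 0 \<or> k = 1 \<or> k = 2" by auto
      ultimately show ?thesis using x by (auto simp: A_def)
    qed
    moreover have "A k \<subseteq> F" for k by (auto simp: A_def)
    ultimately show ?thesis by blast
  qed
  have ne: "(0 :: 'a) \<noteq> 1" "(0 :: 'a) \<noteq> - 1" by simp_all
  have ne': "(1 :: 'a) \<noteq> - 1"
  proof
    assume "(1 :: 'a) = - 1"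
    then have "(2 :: 'a) = 0" by (simp add: eq_neg_iff_add_eq_0)
    then show False using two by simp
  qed
  have disj: "A 1 \<inter> A 2 = {}" "A 0 \<inter> (A 1 \<union> A 2) = {}"
    using ne ne' by (auto simp: A_def two)
  have neg: "abs_trace M (- x + a / (- x)) = - abs_trace M (x + a / x)" for x
    by (simp flip: abs_trace_minus)
  have "bij_betw uminus (A 1) (A 2)"
  proof (rule bij_betw_byWitness[of _ uminus])
    have "- x \<in> A 2" if "x \<in> A 1" for x
      using that neg[of x] uminus_mem[of x] by (simp add: A_def two)
    then show "uminus ` A 1 \<subseteq> A 2" by auto
    have "- x \<in> A 1" if "x \<in> A 2" for x
      using that neg[of x] uminus_mem[of x] by (simp add: A_def two)
    then show "uminus ` A 2 \<subseteq> A 1" by auto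
  qed auto
  then have c2: "card (A 2) = card (A 1)" using bij_betw_same_card by fastforce
  have N: "N = card (A 1)" by (simp add: N_def A_def)
  have card: "card (A 0) + 2 * N = 3 ^ M"
    unfolding card_F[symmetric] F using disj fin c2 N by (simp add: card_Un_disjoint)
  then show "2 * N \<le> 3 ^ M" by linarith
  have "(\<Sum>x\<in>A k. add_char (abs_trace M) (x + a / x)) = of_nat (card (A k)) * omega3 ^ k" for k
    using add_char_of_nat[OF three_eq_0] by (simp add: A_def)
  then have "K_base M a = of_nat (card (A 0)) + of_nat N * (omega3 + omega3 ^ 2)"
    unfolding K_base_def kloost_def F_def[symmetric] F using disj fin c2 N
    by (simp add: sum.union_disjoint algebra_simps)
  also have "omega3 + omega3 ^ 2 = - 1" using omega3_sum by (simp add: eq_neg_iff_add_eq_0 ac_simps)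
  also have "of_nat (card (A 0)) = (of_nat (3 ^ M) - 2 * of_nat N :: complex)"
    unfolding card[symmetric] by simp
  finally show "K_base M a = of_int (3 ^ M - 3 * int N)" by simp
  assume "N = 0" "x \<in> F"
  moreover from this have "A 1 = {}" "A 2 = {}" using N fin c2 by simp_all
  ultimately have "x \<in> A 0" using F by blast
  then show "abs_trace M (x + a / x) = 0" by (simp add: A_def)
qed

text \<open>If all values \<open>x + a / x\<close> had trace 0, the at most two-to-one map \<open>x \<mapsto> x + a / x\<close>
  would send \<open>3 ^ M - 1\<close> elements into a set of size \<open>3 ^ (M - 1)\<close>.\<close>

lemma kloosterman_divisible:
  assumes a: "a \<in> F" and M: "2 \<le> M"
  obtains k where "K_base M a = of_int k" "3 dvd k" "\<bar>k\<bar> < 3 ^ M"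
proof -
  define N where "N = card {x \<in> F. abs_trace M (x + a / x) = 1}"
  note K = kloosterman_integer[OF a, folded N_def]
  have "N \<noteq> 0"
  proof
    assume "N = 0"
    define Z where "Z = {x :: 'a. abs_trace M x = 0}"
    define R where "R c = {x. poly [:a, - c, 1:] x = 0}" for c
    have "F - {0} \<subseteq> (\<Union>c\<in>Z. R c)"
    proof
      fix x assume x: "x \<in> F - {0}"
      then have "x + a / x \<in> Z" using K(3)[OF \<open>N = 0\<close>] by (simp add: Z_def)
      moreover have "x \<in> R (x + a / x)" using x by (simp add: R_def field_simps)
      ultimately show "x \<in> (\<Union>c\<in>Z. R c)" by blast
    qed
    moreover have R: "finite (R c)" "card (R c) \<le> 2" for c
      using poly_roots_finite[of "[:a, - c, 1:]"] card_poly_roots_bound[of "[:a, - c, 1:]"]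
      by (auto simp: R_def)
    moreover have Z: "finite Z" "card Z \<le> 3 ^ (M - 1)"
      unfolding Z_def by (rule card_trace_kernel)+
    ultimately have "card (F - {0}) \<le> card (\<Union>c\<in>Z. R c)"
      by (intro card_mono) auto
    also have "\<dots> \<le> (\<Sum>c\<in>Z. card (R c))" using Z by (intro card_UN_le)
    also have "\<dots> \<le> card Z * 2" using sum_bounded_above[of Z "\<lambda>c. card (R c)" 2] R by simp
    finally have "3 ^ M - 1 \<le> 2 * (3 :: nat) ^ (M - 1)"
      using Z card_F finite_F by simp
    moreover have "(3 :: nat) ^ M = 3 * 3 ^ (M - 1)" using M by (cases M) auto
    \<comment> \<open>The two previous facts leave \<open>3 ^ (M - 1) \<le> 1\<close>, which fails
      for \<open>2 \<le> M\<close>.\<close>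
    moreover have "(3 :: nat) ^ 1 \<le> 3 ^ (M - 1)" using M by (intro power_increasing) auto
    ultimately show False by simp
  qed
  \<comment> \<open>Together with \<open>N \<noteq> 0\<close> this gives
    \<open>0 < 3 * N < 2 * 3 ^ M\<close>.\<close>
  moreover have "int (2 * N) \<le> int (3 ^ M)" using K(2) by (simp only: of_nat_le_iff)
  ultimately have "\<bar>3 ^ M - 3 * int N\<bar> < 3 ^ M" by simp
  moreover have "3 dvd (3 ^ M - 3 * int N)" using M_pos by simp
  ultimately show thesis using that K(1) by blast
qed

end

subsection \<open>The Kloosterman L-function\<close>

text \<open>The value at 0 of the logarithmic derivative \<open>f' / f\<close>, hence additive on
  products. For \<open>\<Prod>(X - x_i)\<close> it is \<open>- \<Sum>(1 / x_i)\<close>, and for the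
  reflected polynomial \<open>\<Prod>(1 - x_i X)\<close> it is \<open>- \<Sum>x_i\<close>.\<close>

definition logd :: "'a::field poly \<Rightarrow> 'a" where
  "logd f = coeff f 1 / coeff f 0"

lemma logd_mult:
  assumes "coeff f 0 \<noteq> 0" "coeff g 0 \<noteq> 0"
  shows "logd (f * g) = logd f + logd g"
  using assms by (simp add: logd_def coeff_mult field_simps)

lemma logd_1: "logd 1 = 0"
  by (simp add: logd_def)

lemma logd_prod:
  assumes "\<And>i. i \<in> A \<Longrightarrow> coeff (f i) 0 \<noteq> 0"
  shows "logd (\<Prod>i\<in>A. f i) = (\<Sum>i\<in>A. logd (f i))"
  using assms
proof (induction A rule: infinite_finite_induct)
  case (insert i A)
  have "coeff (\<Prod>i\<in>A. f i) 0 \<noteq> 0"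
    using insert by (simp add: poly_prod flip: poly_0_coeff_0)
  then show ?case using insert by (simp add: logd_mult)
qed (simp_all add: logd_1)

lemma sum_eq_0_if_rotation:
  fixes g :: "'c \<Rightarrow> complex"
  assumes "bij_betw s A A" "\<And>x. x \<in> A \<Longrightarrow> g (s x) = c * g x" "c \<noteq> 1"
  shows "sum g A = 0"
proof -
  have "sum g A = (\<Sum>x\<in>A. g (s x))"
    by (rule sum.reindex_bij_betw[symmetric, OF assms(1)])
  also have "\<dots> = c * sum g A" by (simp add: sum_distrib_left assms(2))
  finally show ?thesis using assms(3) by simp
qed

context ternary_subfield
begin

text \<open>For \<open>f = \<Prod>(X - x\<^sub>i)\<close> with nonzero roots, the argument of \<open>echar\<close> is \<open>\<Sum>(x\<^sub>i + a / x\<^sub>i)\<close>.\<close>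

definition kl_weight :: "'a \<Rightarrow> 'a poly \<Rightarrow> complex" where
  "kl_weight a f = (if coeff f 0 = 0 then 0 else echar (- logd (reflect_poly f) - a * logd f))"

definition kl_sum :: "'a \<Rightarrow> nat \<Rightarrow> complex" where
  "kl_sum a d = (\<Sum>f \<in> monics d. kl_weight a f)"

lemma reflect_polys: "f \<in> polys \<Longrightarrow> reflect_poly f \<in> polys"
  by (simp add: polys_def coeff_reflect_poly)

lemma logd_mem: "f \<in> polys \<Longrightarrow> logd f \<in> F"
  unfolding logd_def by (intro divide_mem coeff_mem)

text \<open>\<open>logd\<close> turns products into sums and \<open>echar\<close> turns sums back
  into products; if 0 is a root of a factor, both sides vanish.\<close>

lemma kl_weight_mult:
  assumes a: "a \<in> F" and f: "f \<in> polys" "f \<noteq> 0" and g: "g \<in> polys" "g \<noteq> 0"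
  shows "kl_weight a (f * g) = kl_weight a f * kl_weight a g"
proof (cases "coeff f 0 = 0 \<or> coeff g 0 = 0")
  case False
  have mem: "- logd (reflect_poly h) - a * logd h \<in> F" if "h \<in> polys" for h
    by (intro diff_mem uminus_mem mult_mem logd_mem reflect_polys a that)
  have "- logd (reflect_poly (f * g)) - a * logd (f * g) =
      (- logd (reflect_poly f) - a * logd f) + (- logd (reflect_poly g) - a * logd g)"
    using False f g by (simp add: reflect_poly_mult logd_mult algebra_simps)
  then show ?thesis
    using False echar_add[OF mem[OF f(1)] mem[OF g(1)]] by (simp add: kl_weight_def coeff_mult)
qed (auto simp: kl_weight_def coeff_mult)

lemma kl_weight_1: "kl_weight a 1 = 1"
  by (simp add: kl_weight_def logd_1 echar_0)

lemma kl_sum_0: "kl_sum a 0 = 1"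
  by (simp add: kl_sum_def monics_0 kl_weight_1)

lemma bij_betw_plus_F: "t \<in> F \<Longrightarrow> bij_betw (\<lambda>x. x + t) F F"
  by (rule bij_betw_byWitness[of _ "\<lambda>x. x - t"]) (auto simp: add_mem diff_mem)

text \<open>Orthogonality: for nonzero \<open>u\<close>, shifting \<open>b\<close> by
  \<open>t / u\<close> multiplies every term by \<open>echar t \<noteq> 1\<close>.\<close>

lemma sum_echar_mult:
  assumes "u \<in> F"
  shows "(\<Sum>b\<in>F. echar (b * u)) = (if u = 0 then of_nat (3 ^ M) else 0)"
proof (cases "u = 0")
  case False
  obtain t where t: "t \<in> F" "echar t \<noteq> 1" using echar_nontrivial by blast
  have tu: "t / u \<in> F" by (intro divide_mem t assms)
  have "echar ((b + t / u) * u) = echar t * echar (b * u)" if "b \<in> F" for b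
    using False echar_add[OF mult_mem[OF that assms] t(1)] by (simp add: distrib_right)
  then show ?thesis
    using sum_eq_0_if_rotation[OF bij_betw_plus_F[OF tu], of "\<lambda>b. echar (b * u)" "echar t"] t(2) False
    by simp
qed (simp add: echar_0 card_F)

text \<open>The root of \<open>X + c\<close> is \<open>- c\<close>, and the excluded
  \<open>c = 0\<close> accounts for the term 1 of \<open>x = 0\<close> in
  \<open>K_base\<close>.\<close>

lemma kl_sum_1:
  shows "kl_sum a 1 = K_base M a - 1"
proof -
  have weight: "kl_weight a [:c, 1:] = (if c = 0 then 0 else echar (- c - a / c))" for c
    by (simp add: kl_weight_def logd_def coeff_reflect_poly)
  have "monics 1 = (\<lambda>c. [:c, 1:]) ` F"
    using monics_Suc[of 0] by (force simp: monics_0 one_pCons)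
  moreover have "inj_on (\<lambda>c. [:c, 1:]) F" by (auto simp: inj_on_def)
  ultimately have "kl_sum a 1 = (\<Sum>c\<in>F. kl_weight a [:c, 1:])"
    by (simp add: kl_sum_def sum.reindex)
  also have "\<dots> = (\<Sum>c\<in>F - {0}. echar (- c - a / c))"
    using finite_F by (intro sum.mono_neutral_cong_right) (auto simp: weight)
  also have "\<dots> = (\<Sum>x\<in>F - {0}. echar (x + a / x))"
    by (rule sum.reindex_bij_witness[of _ uminus uminus]) (auto simp: uminus_mem)
  also have "\<dots> = K_base M a - 1"
    using finite_F by (subst sum_diff1)
      (auto simp: K_base_def kloost_def echar_0 simp flip: F_def echar_def)
  finally show ?thesis .
qed

text \<open>For nonzero \<open>c\<close> the weight of \<open>X^2 + b X + c\<close> is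
  \<open>echar (- b * (1 + a / c))\<close>, so summing over \<open>b\<close> kills every
  \<open>c\<close> but \<open>- a\<close>.\<close>

lemma kl_sum_2:
  assumes a: "a \<in> F" "a \<noteq> 0"
  shows "kl_sum a 2 = of_nat (3 ^ M)"
proof -
  have weight: "kl_weight a [:c, b, 1:] = (if c = 0 then 0 else echar (b * - (1 + a / c)))" for b c
    by (simp add: kl_weight_def logd_def coeff_reflect_poly algebra_simps)
  have "monics 1 = (\<lambda>c. [:c, 1:]) ` F"
    using monics_Suc[of 0] by (force simp: monics_0 one_pCons)
  then have "monics 2 = (\<lambda>(c, b). [:c, b, 1:]) ` (F \<times> F)"
    using monics_Suc[of 1] by (force simp: numeral_2_eq_2)
  moreover have "inj_on (\<lambda>(c, b). [:c, b, 1:]) (F \<times> F)" by (auto simp: inj_on_def)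
  ultimately have "kl_sum a 2 = (\<Sum>(c, b)\<in>F \<times> F. kl_weight a [:c, b, 1:])"
    by (simp add: kl_sum_def sum.reindex case_prod_unfold)
  also have "\<dots> = (\<Sum>c\<in>F. \<Sum>b\<in>F. kl_weight a [:c, b, 1:])"
    by (rule sum.cartesian_product[symmetric])
  also have "\<dots> = (\<Sum>c\<in>F. if c = - a then of_nat (3 ^ M) else 0)"
  proof (intro sum.cong refl)
    fix c assume c: "c \<in> F"
    show "(\<Sum>b\<in>F. kl_weight a [:c, b, 1:]) = (if c = - a then of_nat (3 ^ M) else 0)"
    proof (cases "c = 0")
      case False
      have "- (1 + a / c) \<in> F" by (intro uminus_mem add_mem divide_mem one_mem a c)
      moreover have "- (1 + a / c) = 0 \<longleftrightarrow> c = - a"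
        using False by (simp add: field_simps eq_neg_iff_add_eq_0 add.commute)
      ultimately show ?thesis using False sum_echar_mult[of "- (1 + a / c)"] by (simp only: weight if_False)
    qed (use a in \<open>simp add: weight\<close>)
  qed
  also have "\<dots> = of_nat (3 ^ M)"
    using finite_F uminus_mem[OF a(1)] by simp
  finally show ?thesis .
qed

text \<open>From degree 3 on, the coefficient of \<open>X^(d - 1)\<close> is separate from the two
  lowest ones. Shifting it by \<open>- t\<close> permutes \<open>monics d\<close> and multiplies
  every weight by \<open>echar t \<noteq> 1\<close>.\<close>

lemma kl_sum_ge_3:
  assumes a: "a \<in> F" and d: "3 \<le> d"
  shows "kl_sum a d = 0"
proof -
  obtain t where t: "t \<in> F" "echar t \<noteq> 1" using echar_nontrivial by blast
  define s :: "'a poly \<Rightarrow> 'a poly" where "s f = f + monom (- t) (d - 1)" for f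
  have monom: "monom c (d - 1) \<in> polys" if "c \<in> F" for c
    using that by (simp add: polys_def)
  have shift: "f + monom c (d - 1) \<in> monics d" if f: "f \<in> monics d" and c: "c \<in> F" for f c
  proof -
    have "degree (monom c (d - 1)) < degree f"
      using f d degree_monom_le[of c "d - 1"] by (auto simp: monics_def)
    then have "degree (f + monom c (d - 1)) = d" and "lead_coeff (f + monom c (d - 1)) = 1"
      using f d by (auto simp: monics_def degree_add_eq_left)
    then show ?thesis using add_polys[OF monics_polys[OF f] monom[OF c]] by (simp add: monics_def)
  qed
  have "bij_betw s (monics d) (monics d)"
  proof (rule bij_betw_byWitness[of _ "\<lambda>f. f + monom t (d - 1)"])
    show "s ` monics d \<subseteq> monics d"
      using shift[OF _ uminus_mem[OF t(1)]] by (auto simp: s_def)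
    show "(\<lambda>f. f + monom t (d - 1)) ` monics d \<subseteq> monics d"
      using shift[OF _ t(1)] by auto
  qed (auto simp: s_def add.assoc add_monom)
  moreover have "kl_weight a (s f) = echar t * kl_weight a f" if f: "f \<in> monics d" for f
  proof -
    have sf: "s f \<in> monics d"
      using shift[OF f uminus_mem[OF t(1)]] by (simp add: s_def)
    have c: "coeff (s f) 0 = coeff f 0" "coeff (s f) 1 = coeff f 1"
      using d by (auto simp: s_def)
    have "logd (reflect_poly h) = coeff h (d - 1)" if "h \<in> monics d" for h
      using that d by (auto simp: logd_def coeff_reflect_poly monics_def)
    then have r: "logd (reflect_poly (s f)) = logd (reflect_poly f) - t"
      using sf f by (simp add: s_def)
    have l: "logd (s f) = logd f" by (simp only: logd_def c)
    have "- logd (reflect_poly f) - a * logd f \<in> F"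
      by (intro diff_mem uminus_mem mult_mem logd_mem reflect_polys a monics_polys[OF f])
    from echar_add[OF t(1) this] show ?thesis
      unfolding kl_weight_def r l c(1) by (simp add: diff_diff_eq add_diff_eq)
  qed
  ultimately show ?thesis
    unfolding kl_sum_def using t(2) by (rule sum_eq_0_if_rotation)
qed

text \<open>The coefficient of \<open>T^j\<close> in \<open>- T L'(T) / L(T)\<close> for
  \<open>L = \<Sum>d. kl_sum a d T^d\<close>; the minus sign makes it the power sum of the inverse
  roots of \<open>L\<close>.\<close>

definition kl_power_sum :: "'a \<Rightarrow> nat \<Rightarrow> complex" where
  "kl_power_sum a j = - (\<Sum>(P, k) \<in> primepows j. of_nat (degree P) * kl_weight a (P ^ k))"

text \<open>Newton's identities between the coefficients of \<open>L\<close> and these power sums,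
  read off from the Euler product.\<close>

lemma kl_newton:
  assumes "a \<in> F"
  shows "of_nat d * kl_sum a d = - (\<Sum>j = 1..d. kl_power_sum a j * kl_sum a (d - j))"
  unfolding kl_sum_def kl_power_sum_def
  using assms monics_nonzero
  by (subst euler_product_convolution[OF finite_F])
    (auto intro!: kl_weight_mult simp: sum_negf dest: monics_polys)

text \<open>With \<open>\<alpha> + \<beta> = 1 - K(a)\<close> and \<open>\<alpha> * \<beta> = 3 ^ M\<close> this says that \<open>kl_power_sum a j = \<alpha> ^ j + \<beta> ^ j\<close>.\<close>

lemma kl_power_sum_recurrence:
  assumes a: "a \<in> F" "a \<noteq> 0"
  shows "kl_power_sum a 1 = 1 - K_base M a"
    and "kl_power_sum a 2 = (1 - K_base M a) ^ 2 - 2 * 3 ^ M"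
    and "3 \<le> d \<Longrightarrow> kl_power_sum a d =
      (1 - K_base M a) * kl_power_sum a (d - 1) - 3 ^ M * kl_power_sum a (d - 2)"
proof -
  show 1: "kl_power_sum a 1 = 1 - K_base M a"
    using kl_newton[OF a(1), of 1] kl_sum_1[of a] by (simp add: kl_sum_0 minus_equation_iff)
  show "kl_power_sum a 2 = (1 - K_base M a) ^ 2 - 2 * 3 ^ M"
  proof -
    have "2 * kl_sum a 2 = - (kl_power_sum a 1 * kl_sum a 1 + kl_power_sum a 2)"
      using kl_newton[OF a(1), of 2] by (simp add: kl_sum_0 numeral_2_eq_2)
    then show ?thesis
      unfolding 1 kl_sum_1 kl_sum_2[OF a] by (simp add: algebra_simps power2_eq_square)
  qed
  assume d: "3 \<le> d"
  \<comment> \<open>\<open>L\<close> has degree 2, so only the indices with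
    \<open>d - j \<le> 2\<close> survive.\<close>
  have "(\<Sum>j = 1..d. kl_power_sum a j * kl_sum a (d - j)) =
      (\<Sum>j \<in> {d - 2, d - 1, d}. kl_power_sum a j * kl_sum a (d - j))"
  proof (intro sum.mono_neutral_right ballI)
    fix j assume "j \<in> {1..d} - {d - 2, d - 1, d}"
    then have "3 \<le> d - j" by auto
    then show "kl_power_sum a j * kl_sum a (d - j) = 0"
      using kl_sum_ge_3[OF a(1)] by simp
  qed (use d in auto)
  also have "\<dots> = kl_power_sum a (d - 2) * kl_sum a 2 + kl_power_sum a (d - 1) * kl_sum a 1 + kl_power_sum a d"
  proof -
    have "d - 2 \<notin> {d - 1, d}" "d - 1 \<notin> {d}" "d - (d - 2) = 2" "d - (d - 1) = 1"
      using d by auto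
    then show ?thesis by (simp add: kl_sum_0)
  qed
  finally have sum: "(\<Sum>j = 1..d. kl_power_sum a j * kl_sum a (d - j)) =
      kl_power_sum a (d - 2) * kl_sum a 2 + kl_power_sum a (d - 1) * kl_sum a 1 + kl_power_sum a d" .
  have "(\<Sum>j = 1..d. kl_power_sum a j * kl_sum a (d - j)) = 0"
    using kl_newton[OF a(1), of d] kl_sum_ge_3[OF a(1) d] by simp
  then have "kl_power_sum a (d - 2) * kl_sum a 2 + kl_power_sum a (d - 1) * kl_sum a 1 + kl_power_sum a d = 0"
    by (simp only: sum)
  then show "kl_power_sum a d =
      (1 - K_base M a) * kl_power_sum a (d - 1) - 3 ^ M * kl_power_sum a (d - 2)"
    unfolding kl_sum_1 kl_sum_2[OF a] by (simp add: algebra_simps eq_neg_iff_add_eq_0 add_eq_0_iff)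
qed

end

subsection \<open>Conjugates in the extension field\<close>

lemma monic_prod_linear:
  fixes y :: "'i \<Rightarrow> 'a::field"
  shows "degree (\<Prod>i\<in>A. [:- y i, 1:]) = card A" "lead_coeff (\<Prod>i\<in>A. [:- y i, 1:]) = 1"
proof -
  have "degree (\<Prod>i\<in>A. [:- y i, 1:]) = card A \<and> lead_coeff (\<Prod>i\<in>A. [:- y i, 1:]) = 1"
  proof (induction A rule: infinite_finite_induct)
    case (insert i A)
    let ?g = "\<Prod>i\<in>A. [:- y i, 1:]"
    have ins: "(\<Prod>i\<in>insert i A. [:- y i, 1:]) = [:- y i, 1:] * ?g"
      using insert.hyps by (rule prod.insert)
    have "?g \<noteq> 0" using insert.IH by auto
    then have "degree ([:- y i, 1:] * ?g) = Suc (card A)"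
      using insert.IH by (subst degree_mult_eq) auto
    moreover have "lead_coeff ([:- y i, 1:] * ?g) = 1"
      unfolding lead_coeff_mult insert.IH[THEN conjunct2] by simp
    ultimately show ?case unfolding ins using insert.hyps by simp
  qed simp_all
  then show "degree (\<Prod>i\<in>A. [:- y i, 1:]) = card A" "lead_coeff (\<Prod>i\<in>A. [:- y i, 1:]) = 1"
    by auto
qed

text \<open>A linear factor at whose root \<open>f\<close> does not vanish must divide the cofactor
  and can be cancelled; if this happened for all factors, \<open>f\<close> would divide 1.\<close>

lemma dvd_prod_linear_root:
  fixes y :: "'i \<Rightarrow> 'a::field"
  assumes "finite A" "f dvd (\<Prod>i\<in>A. [:- y i, 1:])" "0 < degree f"
  shows "\<exists>i\<in>A. poly f (y i) = 0"
  using assms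
proof (induction A rule: finite_induct)
  case empty
  then show ?case using dvd_imp_degree_le[of f 1] by simp
next
  case (insert i A)
  show ?case
  proof (cases "poly f (y i) = 0")
    case False
    obtain h where h: "[:- y i, 1:] * (\<Prod>i\<in>A. [:- y i, 1:]) = f * h"
      using insert.prems(1) insert.hyps by (auto elim!: dvdE)
    have "poly (f * h) (y i) = 0" unfolding h[symmetric] by simp
    then have "poly h (y i) = 0" using False by simp
    then obtain h' where "h = [:- y i, 1:] * h'" by (auto simp: poly_eq_0_iff_dvd elim!: dvdE)
    then have "[:- y i, 1:] * (\<Prod>i\<in>A. [:- y i, 1:]) = [:- y i, 1:] * (f * h')"
      using h by (simp only: mult.left_commute)
    then have "(\<Prod>i\<in>A. [:- y i, 1:]) = f * h'"
      by (simp only: mult_cancel_left) simp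
    then show ?thesis using insert by auto
  qed auto
qed

lemma map_poly_power_mult:
  assumes "(3 :: 'a::field) = 0"
  shows "map_poly (\<lambda>c. c ^ (3 ^ k)) (f * g :: 'a poly) =
    map_poly (\<lambda>c. c ^ (3 ^ k)) f * map_poly (\<lambda>c. c ^ (3 ^ k)) g"
  by (rule poly_eqI)
    (simp add: coeff_map_poly coeff_mult sum_power_3_power[OF assms] power_mult_distrib zero_power)

lemma map_poly_power_prod:
  assumes "(3 :: 'a::field) = 0"
  shows "map_poly (\<lambda>c. c ^ (3 ^ k)) (\<Prod>i\<in>A. f i :: 'a poly) = (\<Prod>i\<in>A. map_poly (\<lambda>c. c ^ (3 ^ k)) (f i))"
  by (induction A rule: infinite_finite_induct)
    (simp_all add: map_poly_power_mult[OF assms])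

context ternary_subfield
begin

lemma pow_q_pow: "x \<in> F \<Longrightarrow> x ^ (3 ^ M) ^ i = x"
  by (induction i) (auto simp: F_def Fq_def power_mult)

text \<open>Frobenius is a ring homomorphism fixing the coefficients. Hence a polynomial over
  \<open>F\<close> that vanishes at a conjugate of \<open>x\<close> vanishes at
  \<open>x\<close>.\<close>

lemma poly_frobenius:
  assumes "f \<in> polys"
  shows "poly f (x ^ (3 ^ M) ^ i) = poly f x ^ (3 ^ M) ^ i"
proof -
  have "poly f x ^ (3 ^ M) ^ i = (\<Sum>j\<le>degree f. (coeff f j * x ^ j) ^ (3 ^ M) ^ i)"
    unfolding poly_altdef power_mult[symmetric] by (rule sum_power_3_power[OF three_eq_0])
  also have "\<dots> = (\<Sum>j\<le>degree f. coeff f j * (x ^ (3 ^ M) ^ i) ^ j)"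
  proof (intro sum.cong refl)
    fix j
    have "(x ^ j) ^ (3 ^ M) ^ i = (x ^ (3 ^ M) ^ i) ^ j"
      by (simp only: power_mult[of x, symmetric] mult.commute)
    then show "(coeff f j * x ^ j) ^ (3 ^ M) ^ i = coeff f j * (x ^ (3 ^ M) ^ i) ^ j"
      by (simp only: power_mult_distrib pow_q_pow[OF coeff_mem[OF assms]])
  qed
  finally show ?thesis by (simp add: poly_altdef)
qed

lemma irreds_dvd_if_root:
  assumes "P \<in> irreds" "f \<in> polys" "poly P x = 0" "poly f x = 0"
  shows "P dvd f"
proof (rule ccontr)
  assume "\<not> P dvd f"
  then obtain u v where "u * P + v * f = 1"
    using irreds_bezout[OF assms(1,2)] by blast
  then have "poly (u * P + v * f) x = poly 1 x" by simp
  then show False using assms by simp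
qed

text \<open>The characteristic polynomial over \<open>F\<close> of an element \<open>x\<close> of
  the extension of degree \<open>n\<close>; conjugates are repeated if \<open>x\<close> generates a
  smaller field.\<close>

definition conj_poly :: "nat \<Rightarrow> 'a \<Rightarrow> 'a poly" where
  "conj_poly n x = (\<Prod>i<n. [:- (x ^ (3 ^ M) ^ i), 1:])"

text \<open>Applying Frobenius to the coefficients rotates the linear factors cyclically, so each
  coefficient is fixed and lies in \<open>F\<close>.\<close>

lemma conj_poly_monics:
  assumes x: "x ^ (3 ^ M) ^ n = x"
  shows "conj_poly n x \<in> monics n"
proof -
  have lin: "map_poly (\<lambda>c. c ^ (3 ^ M)) [:- (x ^ (3 ^ M) ^ i), 1:] = [:- (x ^ (3 ^ M) ^ Suc i), 1:]" for i
    by (simp add: map_poly_pCons power_minus_odd mult.commute flip: power_mult)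
  have "map_poly (\<lambda>c. c ^ (3 ^ M)) (conj_poly n x) = (\<Prod>i<n. [:- (x ^ (3 ^ M) ^ Suc i), 1:])"
    unfolding conj_poly_def map_poly_power_prod[OF three_eq_0] lin ..
  also have "\<dots> = conj_poly n x"
  proof (cases n)
    case (Suc k)
    have "(\<Prod>i<n. [:- (x ^ (3 ^ M) ^ Suc i), 1:]) = (\<Prod>i<k. [:- (x ^ (3 ^ M) ^ Suc i), 1:]) * [:- (x ^ (3 ^ M) ^ 0), 1:]"
      using x by (simp add: Suc)
    also have "\<dots> = conj_poly n x"
      unfolding conj_poly_def Suc prod.lessThan_Suc_shift by (simp add: mult.commute)
    finally show ?thesis .
  qed (simp add: conj_poly_def)
  finally have "map_poly (\<lambda>c. c ^ (3 ^ M)) (conj_poly n x) = conj_poly n x" .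
  then have "coeff (conj_poly n x) i ^ (3 ^ M) = coeff (conj_poly n x) i" for i
    by (metis (no_types, lifting) coeff_map_poly zero_power zero_less_power zero_less_numeral)
  then have "coeff (conj_poly n x) i \<in> F" for i by (simp add: F_def Fq_def)
  then have "conj_poly n x \<in> polys" by (simp add: polys_def)
  then show ?thesis
    using monic_prod_linear[of "\<lambda>i. x ^ (3 ^ M) ^ i" "{..<n}"] by (simp add: monics_def conj_poly_def)
qed

lemma poly_conj_poly_eq_0: "0 < n \<Longrightarrow> poly (conj_poly n x) x = 0"
  by (auto simp: conj_poly_def poly_prod intro!: bexI[of _ 0])

text \<open>A nonconstant divisor over \<open>F\<close> vanishes at some conjugate of
  \<open>x\<close>, hence at \<open>x\<close>, hence is divisible by \<open>P\<close>; the quotient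
  is treated in the same way.\<close>

lemma dvd_conj_poly_power:
  assumes P: "P \<in> irreds" "poly P x = 0" and f: "f \<in> monics e" "f dvd conj_poly n x"
  shows "\<exists>k. f = P ^ k"
  using f
proof (induction e arbitrary: f rule: less_induct)
  case (less e)
  show ?case
  proof (cases "e = 0")
    case True
    then show ?thesis using less.prems monics_0 by (intro exI[of _ 0]) simp
  next
    case False
    then obtain i where "poly f (x ^ (3 ^ M) ^ i) = 0"
      using dvd_prod_linear_root[of "{..<n}" f "\<lambda>i. x ^ (3 ^ M) ^ i"] less.prems
      by (auto simp: conj_poly_def monics_def)
    then have "poly f x = 0"
      using poly_frobenius[OF monics_polys[OF less.prems(1)]] by simp
    then have "P dvd f"
      using irreds_dvd_if_root[OF P(1) monics_polys[OF less.prems(1)] P(2)] by simp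
    then obtain g where g: "g \<in> monics (e - degree P)" "f = P * g"
      using monics_dvdE[OF less.prems(1) irreds_monics[OF P(1)]] by blast
    have "g dvd conj_poly n x" using less.prems(2) g(2) by (metis dvd_mult_right)
    then obtain k where "g = P ^ k"
      using less.IH[OF _ g(1)] irreds_degree[OF P(1)] False by auto
    then show ?thesis using g(2) by (intro exI[of _ "Suc k"]) simp
  qed
qed

lemma conj_poly_primepow:
  assumes x: "x ^ (3 ^ M) ^ n = x" and n: "0 < n"
  shows "\<exists>P k. (P, k) \<in> primepows n \<and> poly P x = 0 \<and> conj_poly n x = P ^ k"
proof -
  obtain P where P: "P \<in> irreds" "poly P x = 0"
    using ex_irred_root[OF conj_poly_monics[OF x] poly_conj_poly_eq_0[OF n]] by blast
  obtain k where k: "conj_poly n x = P ^ k"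
    using dvd_conj_poly_power[OF P conj_poly_monics[OF x] dvd_refl] by blast
  have "degree (P ^ k) = n"
    using conj_poly_monics[OF x] k by (simp add: monics_def)
  moreover have "P \<noteq> 0" using irreds_degree[OF P(1)] by auto
  ultimately have "k * degree P = n" by (simp add: degree_power_eq)
  then have "(P, k) \<in> primepows n" using P(1) n by (cases k) (auto simp: primepows_def)
  then show ?thesis using P(2) k by blast
qed

lemma rel_trace_add: "rel_trace (3 ^ M) n (x + y :: 'a) = rel_trace (3 ^ M) n x + rel_trace (3 ^ M) n y"
  by (simp add: rel_trace_def add_power_3_power[OF three_eq_0] sum.distrib flip: power_mult)

lemma rel_trace_mult: "c \<in> F \<Longrightarrow> rel_trace (3 ^ M) n (c * x) = c * rel_trace (3 ^ M) n x"
  by (simp add: rel_trace_def power_mult_distrib pow_q_pow sum_distrib_left)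

text \<open>Adding up \<open>logd\<close> over the linear factors produces the relative traces of
  \<open>x\<close> and \<open>1 / x\<close>, and \<open>a \<in> F\<close> passes through the trace.
  For nonzero \<open>x\<close> this makes the weight a term of \<open>K_ext\<close>.\<close>

lemma kl_weight_conj_poly:
  assumes "a \<in> F" "0 < n"
  shows "kl_weight a (conj_poly n x) =
    (if x = 0 then 0 else add_char (\<lambda>b. abs_trace M (rel_trace (3 ^ M) n b)) (x + a / x))"
proof (cases "x = 0")
  case True
  have "coeff (conj_poly n x) 0 = 0"
    using poly_conj_poly_eq_0[OF assms(2), of x] True by (simp add: poly_0_coeff_0)
  then show ?thesis using True by (simp add: kl_weight_def)
next
  case False
  have ne: "coeff (conj_poly n x) 0 \<noteq> 0"
    using False by (simp add: conj_poly_def poly_prod flip: poly_0_coeff_0)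
  have "logd (conj_poly n x) = (\<Sum>i<n. logd [:- (x ^ (3 ^ M) ^ i), 1:])"
    unfolding conj_poly_def using False by (intro logd_prod) simp
  then have l: "logd (conj_poly n x) = - rel_trace (3 ^ M) n (1 / x)"
    by (simp add: logd_def rel_trace_def power_one_over sum_negf)
  have "logd (reflect_poly (conj_poly n x)) = (\<Sum>i<n. logd (reflect_poly [:- (x ^ (3 ^ M) ^ i), 1:]))"
    unfolding conj_poly_def reflect_poly_prod by (intro logd_prod) simp
  then have r: "logd (reflect_poly (conj_poly n x)) = - rel_trace (3 ^ M) n x"
    by (simp add: logd_def rel_trace_def coeff_reflect_poly sum_negf)
  have "rel_trace (3 ^ M) n (x + a / x) = rel_trace (3 ^ M) n x + a * rel_trace (3 ^ M) n (1 / x)"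
    using rel_trace_mult[OF assms(1), of n "1 / x"] by (simp add: rel_trace_add)
  then show ?thesis
    using ne False by (simp add: kl_weight_def l r echar_def add_char_def)
qed

end

section \<open>The extension field fibred over prime powers\<close>

locale ternary_extension = ternary_subfield F M for F :: "'a::{field, finite} set" and M +
  fixes n :: nat
  assumes card_ext: "card (UNIV :: 'a set) = 3 ^ (M * n)" and n_pos: "0 < n"
begin

lemma pow_q_n: "x ^ (3 ^ M) ^ n = (x :: 'a)"
  using power_card_UNIV[of x] by (simp add: card_ext power_mult)

text \<open>The fibre over \<open>P ^ k\<close> consists of roots of \<open>P\<close>, and the degrees of the prime powers add up
  to the size of the field, so it consists of exactly \<open>degree P\<close> elements.\<close>

lemma sum_conj_poly:
  fixes g :: "'a poly \<Rightarrow> 'c::comm_ring_1"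
  shows "(\<Sum>x\<in>UNIV. g (conj_poly n x)) = (\<Sum>(P, k) \<in> primepows n. of_nat (degree P) * g (P ^ k))"
proof -
  have "\<exists>p. p \<in> primepows n \<and> poly (fst p) x = 0 \<and> conj_poly n x = fst p ^ snd p" for x
    using conj_poly_primepow[OF pow_q_n n_pos] by fastforce
  then obtain \<mu> where \<mu>: "\<And>x. \<mu> x \<in> primepows n" "\<And>x. poly (fst (\<mu> x)) x = 0"
      "\<And>x. conj_poly n x = fst (\<mu> x) ^ snd (\<mu> x)"
    by metis
  have fin: "finite (primepows n)" by (rule finite_primepows[OF finite_F n_pos])
  have le: "card {x. \<mu> x = p} \<le> degree (fst p)" if "p \<in> primepows n" for p
  proof -
    have "fst p \<noteq> 0" using that irreds_degree by (force simp: primepows_def)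
    have "card {x. \<mu> x = p} \<le> card {x. poly (fst p) x = 0}"
      using \<mu>(2) by (intro card_mono) auto
    also have "\<dots> \<le> degree (fst p)" by (rule card_poly_roots_bound[OF \<open>fst p \<noteq> 0\<close>])
    finally show ?thesis .
  qed
  have "(\<Sum>p \<in> primepows n. card {x. \<mu> x = p}) = (\<Sum>p \<in> primepows n. \<Sum>x \<in> {x \<in> UNIV. \<mu> x = p}. 1)"
    by simp
  also have "\<dots> = card (UNIV :: 'a set)"
    using \<mu>(1) fin by (subst sum.group) auto
  also have "\<dots> = (\<Sum>p \<in> primepows n. degree (fst p))"
    using sum_degree_primepows[OF finite_F n_pos]
    by (simp add: card_ext card_F power_mult case_prod_beta)
  finally have eq: "card {x. \<mu> x = p} = degree (fst p)" if "p \<in> primepows n" for p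
    using that le fin by (intro sum_mono_inv[of "\<lambda>p. card {x. \<mu> x = p}" "primepows n" "\<lambda>p. degree (fst p)"])
  have "(\<Sum>x\<in>UNIV. g (conj_poly n x)) = (\<Sum>p \<in> primepows n. \<Sum>x \<in> {x \<in> UNIV. \<mu> x = p}. g (conj_poly n x))"
    using \<mu>(1) fin by (subst sum.group) auto
  also have "\<dots> = (\<Sum>p \<in> primepows n. \<Sum>x \<in> {x. \<mu> x = p}. g (fst p ^ snd p))"
    using \<mu>(3) by (intro sum.cong) auto
  also have "\<dots> = (\<Sum>p \<in> primepows n. of_nat (degree (fst p)) * g (fst p ^ snd p))"
    by (intro sum.cong) (simp_all add: eq)
  finally show ?thesis by (simp add: case_prod_beta)
qed

lemma K_ext_eq:
  assumes "a \<in> F"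
  shows "K_ext M n a = 1 - kl_power_sum a n"
proof -
  let ?e = "add_char (\<lambda>b :: 'a. abs_trace M (rel_trace (3 ^ M) n b))"
  have "?e 0 = 1"
    using add_char_of_nat[OF three_eq_0, of _ 0 0] by (simp add: abs_trace_def rel_trace_def zero_power)
  then have "K_ext M n a = 1 + (\<Sum>x \<in> UNIV - {0}. ?e (x + a / x))"
    unfolding K_ext_def kloost_def by (subst sum.remove[of _ 0]) auto
  also have "(\<Sum>x \<in> UNIV - {0}. ?e (x + a / x)) = (\<Sum>x \<in> UNIV. kl_weight a (conj_poly n x))"
    unfolding kl_weight_conj_poly[OF assms n_pos] by (intro sum.mono_neutral_cong_left) auto
  finally show ?thesis by (simp add: sum_conj_poly kl_power_sum_def)
qed

end

subsection \<open>3-adic valuations\<close>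

text \<open>The Lucas sequence of \<open>X^2 - t X + q\<close>: the power sums of its two roots,
  kept inside the integers.\<close>

fun lucas :: "int \<Rightarrow> int \<Rightarrow> nat \<Rightarrow> int" where
  "lucas t q 0 = 2"
| "lucas t q (Suc 0) = t"
| "lucas t q (Suc (Suc k)) = t * lucas t q (Suc k) - q * lucas t q k"

lemma lucas_eq_power_sum:
  fixes \<alpha> \<beta> :: "'a::comm_ring_1"
  assumes "\<alpha> + \<beta> = of_int t" "\<alpha> * \<beta> = of_int q"
  shows "of_int (lucas t q k) = \<alpha> ^ k + \<beta> ^ k"
  by (induction k rule: induct_nat_012) (simp_all add: algebra_simps flip: assms)

lemma lucas_mod_3:
  assumes "3 dvd t - 1" "3 dvd q" "0 < k"
  shows "3 dvd lucas t q k - 1"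
  using assms
proof (induction t q k rule: lucas.induct)
  case (3 t q k)
  obtain c where c: "lucas t q (Suc k) - 1 = 3 * c" using 3 by (auto elim!: dvdE)
  have "lucas t q (Suc (Suc k)) - 1 = (t - 1) + 3 * (c * t) - q * lucas t q k"
    using c by (simp add: algebra_simps)
  also have "3 dvd \<dots>"
    by (rule dvd_diff[OF dvd_add[OF 3(3) dvd_triv_left] dvd_mult2[OF 3(4)]])
  finally show ?case .
qed auto

text \<open>For \<open>t = 1 - K(a)\<close> and \<open>q = 3 ^ m\<close> the values at
  \<open>k = 1\<close> and \<open>k = n\<close> are \<open>q + K(a)\<close> and
  \<open>q^n + K_n(a)\<close>.\<close>

definition lucas_norm :: "int \<Rightarrow> int \<Rightarrow> nat \<Rightarrow> int" where
  "lucas_norm t q k = q ^ k + 1 - lucas t q k"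

text \<open>With \<open>x = \<alpha>^k\<close> and \<open>y = \<beta>^k\<close>, the second factor
  is \<open>(1 + x + x^2) * (1 + y + y^2)\<close> expressed through \<open>x + y\<close> and
  \<open>x * y\<close>.\<close>

lemma lucas_norm_triple:
  fixes t q :: int
  defines "S \<equiv> lucas t q"
  shows "lucas_norm t q (3 * k) = lucas_norm t q k *
    (1 + S k + S k ^ 2 - q ^ k + (q ^ k) ^ 2 + q ^ k * S k)"
proof -
  define r :: complex where "r = csqrt (of_int (t ^ 2 - 4 * q))"
  define x where "x = ((of_int t + r) / 2) ^ k"
  define y where "y = ((of_int t - r) / 2) ^ k"
  have "r ^ 2 = of_int (t ^ 2 - 4 * q)" by (simp add: r_def)
  then have sum: "(of_int t + r) / 2 + (of_int t - r) / 2 = of_int t"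
    and prod: "(of_int t + r) / 2 * ((of_int t - r) / 2) = of_int q"
    by (simp_all add: field_simps power2_eq_square)
  have S: "of_int (S k) = x + y"
    unfolding S_def x_def y_def by (rule lucas_eq_power_sum[OF sum prod])
  have S3: "of_int (S (3 * k)) = x ^ 3 + y ^ 3"
    unfolding S_def x_def y_def
    by (subst lucas_eq_power_sum[OF sum prod]) (simp add: mult.commute flip: power_mult)
  have Q: "of_int (q ^ k) = x * y"
    unfolding x_def y_def by (simp flip: prod power_mult_distrib)
  have "(of_int (lucas_norm t q (3 * k)) :: complex) =
      of_int ((q ^ k) ^ 3 + 1 - S (3 * k))"
    by (simp add: lucas_norm_def S_def mult.commute flip: power_mult)
  also have "\<dots> = (x * y) ^ 3 + 1 - (x ^ 3 + y ^ 3)"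
    by (simp only: of_int_add of_int_diff of_int_1 of_int_power[of "q ^ k"] Q S3)
  also have "\<dots> = (x * y + 1 - (x + y)) *
      (1 + (x + y) + (x + y) ^ 2 - x * y + (x * y) ^ 2 + (x * y) * (x + y))"
    by (simp add: power2_eq_square power3_eq_cube algebra_simps)
  also have "\<dots> = of_int (lucas_norm t q k *
      (1 + S k + S k ^ 2 - q ^ k + (q ^ k) ^ 2 + q ^ k * S k))"
    unfolding lucas_norm_def S_def[symmetric]
    by (simp only: of_int_mult of_int_add of_int_diff of_int_1 of_int_power[of "q ^ k"] of_int_power[of "S k"] Q S)
  finally show ?thesis by (simp only: of_int_eq_iff)
qed

text \<open>The increments satisfy the Lucas recurrence up to a multiple of
  \<open>lucas_norm t q 1\<close>, so all are divisible by it. Modulo 3, where \<open>t\<close> is 1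
  and \<open>q\<close> is 0, the recurrence passes the quotient on unchanged.\<close>

lemma lucas_norm_diff:
  assumes "3 dvd t - 1" "3 dvd q"
  shows "\<exists>e. lucas_norm t q (Suc k) - lucas_norm t q k = lucas_norm t q 1 * e \<and> 3 dvd e - 1"
    (is "?P k")
proof -
  have "?P k \<and> ?P (Suc k)"
  proof (induction k)
    case 0
    have "?P 0" by (intro exI[of _ 1]) (simp add: lucas_norm_def)
    \<comment> \<open>The witness comes from
      \<open>lucas_norm t q 2 = lucas_norm t q 1 * (1 + q + t)\<close>.\<close>
    moreover have "?P (Suc 0)"
    proof (intro exI[of _ "q + t"] conjI)
      have "3 dvd q + (t - 1)" using assms by (intro dvd_add)
      then show "3 dvd q + t - 1" by (simp add: algebra_simps)
    qed (simp add: lucas_norm_def algebra_simps power2_eq_square)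
    ultimately show ?case by simp
  next
    case (Suc k)
    then obtain e e' where e: "lucas_norm t q (Suc k) - lucas_norm t q k = lucas_norm t q 1 * e"
      and e': "lucas_norm t q (Suc (Suc k)) - lucas_norm t q (Suc k) = lucas_norm t q 1 * e'" "3 dvd e' - 1"
      by blast
    define e'' where "e'' = t * e' - q * e - (1 - q) * q ^ Suc k"
    have "lucas_norm t q (Suc (Suc (Suc k))) - lucas_norm t q (Suc (Suc k)) =
        t * (lucas_norm t q (Suc (Suc k)) - lucas_norm t q (Suc k))
        - q * (lucas_norm t q (Suc k) - lucas_norm t q k)
        - lucas_norm t q 1 * ((1 - q) * q ^ Suc k)"
      by (simp add: lucas_norm_def algebra_simps)
    also have "\<dots> = lucas_norm t q 1 * e''"
      unfolding e e'(1) e''_def by (simp add: algebra_simps)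
    finally have "lucas_norm t q (Suc (Suc (Suc k))) - lucas_norm t q (Suc (Suc k)) = lucas_norm t q 1 * e''" .
    moreover have "3 dvd t * (e' - 1) + (t - 1) - q * (e + (1 - q) * q ^ k)"
      by (rule dvd_diff[OF dvd_add[OF dvd_mult[OF e'(2)] assms(1)] dvd_mult2[OF assms(2)]])
    then have "3 dvd e'' - 1" by (simp add: e''_def algebra_simps)
    ultimately show ?case using Suc by blast
  qed
  then show ?thesis ..
qed

text \<open>A sum of \<open>k\<close> increments whose quotients are congruent to 1 modulo 3. For
  \<open>k\<close> prime to 3 the factor \<open>R\<close> therefore adds nothing to the
  valuation.\<close>

lemma lucas_norm_factor:
  assumes "3 dvd t - 1" "3 dvd q"
  shows "\<exists>R. lucas_norm t q k = lucas_norm t q 1 * R \<and> 3 dvd R - int k"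
proof (induction k)
  case 0
  show ?case by (intro exI[of _ 0]) (simp add: lucas_norm_def)
next
  case (Suc k)
  then obtain R where R: "lucas_norm t q k = lucas_norm t q 1 * R" "3 dvd R - int k" by blast
  obtain e where e: "lucas_norm t q (Suc k) - lucas_norm t q k = lucas_norm t q 1 * e" "3 dvd e - 1"
    using lucas_norm_diff[OF assms] by blast
  have "lucas_norm t q (Suc k) = lucas_norm t q 1 * (R + e)"
    using R e by (simp add: algebra_simps)
  moreover have "3 dvd (R - int k) + (e - 1)" using R e by (intro dvd_add)
  then have "3 dvd (R + e) - int (Suc k)" by (simp add: algebra_simps)
  ultimately show ?case by blast
qed

text \<open>Over the splitting field, \<open>lucas_norm t q k = (1 - \<alpha>^k) * (1 - \<beta>^k)\<close> with \<open>\<alpha> + \<beta> = t\<close>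
  and \<open>\<alpha> * \<beta> = q\<close>, where \<open>\<alpha>\<close> is a 3-adic
  unit congruent to 1 and \<open>\<beta>\<close> is divisible by 3: lifting the exponent.\<close>

lemma multiplicity_lucas_norm:
  assumes t: "3 dvd t - 1" and q: "9 dvd q" and ne: "lucas_norm t q 1 \<noteq> 0" and s: "coprime s (3 :: nat)"
  shows "lucas_norm t q (3 ^ h * s) \<noteq> 0 \<and>
    multiplicity 3 (lucas_norm t q (3 ^ h * s)) = multiplicity 3 (lucas_norm t q 1) + h"
proof (induction h)
  case 0
  have "3 dvd q" using q by (rule dvd_trans[rotated]) simp
  then obtain R where R: "lucas_norm t q s = lucas_norm t q 1 * R" "3 dvd R - int s"
    using lucas_norm_factor[OF t] by blast
  have "\<not> 3 dvd s"
    using s by (metis coprime_common_divisor_nat dvd_refl numeral_eq_one_iff semiring_norm(84))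
  then have "\<not> 3 dvd int s" by presburger
  then have "\<not> 3 dvd R" using R(2) by presburger
  moreover from this have "R \<noteq> 0" by auto
  ultimately show ?case
    using R(1) ne by (simp add: prime_elem_multiplicity_mult_distrib not_dvd_imp_multiplicity_0)
next
  case (Suc h)
  define k where "k = 3 ^ h * s"
  define S where "S = lucas t q k"
  define R where "R = 1 + S + S ^ 2 - q ^ k + (q ^ k) ^ 2 + q ^ k * S"
  have "s \<noteq> 0" by (rule notI) (use s in simp)
  then have k: "0 < k" by (simp add: k_def)
  have "3 dvd q" using q by (rule dvd_trans[rotated]) simp
  then have "3 dvd S - 1" unfolding S_def using lucas_mod_3[OF t _ k] by blast
  then obtain c where c: "S = 1 + 3 * c" by (auto elim!: dvdE simp: algebra_simps)
  have "9 dvd q ^ k" using q k by (meson dvd_power dvd_trans)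
  then obtain d where d: "q ^ k = 9 * d" by (auto elim!: dvdE)
  \<comment> \<open>With \<open>S = 1 + 3 * c\<close> one has
    \<open>1 + S + S^2 = 3 + 9 * (c + c^2)\<close>, and the other terms are divisible by
    \<open>q ^ k\<close>; so tripling the index gains exactly one factor 3.\<close>
  have "R = 3 + 9 * (c + c ^ 2 - d + 9 * d ^ 2 + d * S)"
    unfolding R_def d by (simp add: c algebra_simps power2_eq_square)
  then obtain w where w: "R = 3 + 9 * w" by blast
  have "3 dvd R" "\<not> 9 dvd R" "R \<noteq> 0" unfolding w by presburger+
  then have "multiplicity 3 R = 1" by (intro multiplicity_eqI) simp_all
  moreover note \<open>R \<noteq> 0\<close>
  moreover have "lucas_norm t q (3 ^ Suc h * s) = lucas_norm t q k * R"
    using lucas_norm_triple[of t q k] by (simp add: k_def R_def S_def mult.assoc)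
  ultimately show ?case
    using Suc by (simp add: prime_elem_multiplicity_mult_distrib k_def)
qed

section \<open>Valuations of rational integers among the Eisenstein integers\<close>

lemma three_pow_dvd_of_int: "three_pow_dvd j (of_int k) \<longleftrightarrow> 3 ^ j dvd k"
proof
  assume "three_pow_dvd j (of_int k)"
  then obtain u v :: int where uv: "of_int k = 3 ^ j * (of_int u + of_int v * omega3)"
    unfolding three_pow_dvd_def by blast
  have pow: "(3 :: complex) ^ j = of_real (3 ^ j)" by simp
  \<comment> \<open>Comparing imaginary parts forces \<open>v = 0\<close>, since
    \<open>omega3\<close> is not real.\<close>
  have "Im (of_int k) = 3 ^ j * (of_int v * Im omega3)"
    unfolding uv pow by (simp del: of_real_power)
  moreover have "Im omega3 \<noteq> 0" by (simp add: omega3_def sin_120)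
  ultimately have "v = 0" by simp
  then have "(of_int k :: complex) = of_int (3 ^ j * u)" using uv by simp
  then show "3 ^ j dvd k" by (simp only: of_int_eq_iff) simp
next
  assume "3 ^ j dvd k"
  then obtain u where "k = 3 ^ j * u" by (elim dvdE)
  then show "three_pow_dvd j (of_int k)"
    unfolding three_pow_dvd_def by (intro exI[of _ u] exI[of _ 0]) simp
qed

text \<open>A nonzero \<open>k\<close> below \<open>3 ^ d\<close> in absolute value has valuation
  below \<open>d\<close>, so adding \<open>3 ^ d\<close> does not change it. For
  \<open>k = 0\<close> the default \<open>d\<close> is exactly the valuation of
  \<open>3 ^ d\<close>.\<close>

lemma val3_of_int:
  assumes "\<bar>k\<bar> < 3 ^ d"
  shows "val3 d (of_int k) = multiplicity 3 (k + 3 ^ d)"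
proof (cases "k = 0")
  case False
  define l where "l = multiplicity 3 k"
  have dvd: "3 ^ j dvd k \<longleftrightarrow> j \<le> l" for j
    using False by (simp add: l_def power_dvd_iff_le_multiplicity)
  have "val3 d (of_int k) = (GREATEST j. 3 ^ j dvd k)"
    using False by (simp add: val3_def three_pow_dvd_of_int)
  also have "\<dots> = l" by (rule Greatest_equality) (auto simp: dvd)
  also have "\<dots> = multiplicity 3 (k + 3 ^ d)"
  proof (rule multiplicity_eqI[symmetric])
    have "3 ^ l \<le> \<bar>k\<bar>" using False dvd[of l] zdvd_imp_le[of "3 ^ l" "\<bar>k\<bar>"] by simp
    then have "(3 :: int) ^ l < 3 ^ d" using assms by linarith
    then have "l < d" by simp
    then have "(3 :: int) ^ l dvd 3 ^ d" "(3 :: int) ^ Suc l dvd 3 ^ d"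
      by (auto intro!: le_imp_power_dvd simp del: power_Suc)
    then show "3 ^ l dvd k + 3 ^ d" "\<not> 3 ^ Suc l dvd k + 3 ^ d"
      using dvd[of l] dvd[of "Suc l"] by (auto simp: dvd_add_left_iff simp del: power_Suc)
  qed
  finally show ?thesis .
qed (simp add: val3_def)

section \<open>Size of the subfield and transitivity of the trace\<close>

lemma card_Fq:
  assumes card: "card (UNIV :: 'a::{field, finite} set) = 3 ^ (m * n)"
    and "0 < m" "0 < n" and three: "(3 :: 'a) = 0"
  shows "card (Fq (3 ^ m) :: 'a set) = 3 ^ m"
proof (rule antisym)
  let ?F = "Fq (3 ^ m) :: 'a set"
  define p :: "'a poly" where "p = monom 1 (3 ^ m) + [:0, - 1:]"
  have "(3 :: nat) ^ m > 1" using assms(2) by (intro one_less_power) auto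
  then have "degree p = 3 ^ m"
    unfolding p_def by (subst degree_add_eq_left) (auto simp: degree_monom_eq)
  moreover from this have "p \<noteq> 0" by auto
  moreover have "?F = {x. poly p x = 0}" by (simp add: Fq_def p_def poly_monom)
  ultimately show "card ?F \<le> 3 ^ m" using card_poly_roots_bound[of p] by simp
  \<comment> \<open>For the lower bound, the relative trace sends all \<open>q^n\<close> elements
    into \<open>?F\<close> with fibres of size at most \<open>q^(n - 1)\<close>.\<close>
  let ?T = "\<lambda>x :: 'a. \<Sum>i<n. x ^ ((3 ^ m) ^ i)"
  have "?T x \<in> ?F" for x
  proof -
    have "?T x ^ 3 ^ m = (\<Sum>i<n. x ^ ((3 ^ m) ^ Suc i))"
      by (simp add: sum_power_3_power[OF three] mult.commute flip: power_mult)
    moreover have "x ^ ((3 ^ m) ^ n) = x"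
      using power_card_UNIV[of x] card by (simp add: power_mult)
    ultimately show ?thesis
      using sum.lessThan_Suc_shift[of "\<lambda>i. x ^ ((3 ^ m) ^ i)" n] by (simp add: Fq_def)
  qed
  then have "(\<Sum>c\<in>?F. \<Sum>x\<in>{x \<in> UNIV. ?T x = c}. 1 :: nat) = (\<Sum>x\<in>(UNIV :: 'a set). 1)"
    by (intro sum.group) auto
  then have "3 ^ (m * n) = (\<Sum>c\<in>?F. card {x. ?T x = c})" using card by simp
  also have "\<dots> \<le> (\<Sum>c\<in>?F. (3 ^ m) ^ (n - 1))"
    using card_power_sum_fibre[of "3 ^ m" n] \<open>3 ^ m > 1\<close> assms by (intro sum_mono) auto
  finally have "3 ^ m * (3 ^ m) ^ (n - 1) \<le> card ?F * (3 ^ m) ^ (n - 1)"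
    using \<open>0 < n\<close> by (simp add: power_mult flip: power_Suc)
  then show "3 ^ m \<le> card ?F" by simp
qed

text \<open>The exponents \<open>i * m + j\<close> run exactly once through
  \<open>0, ..., m * n - 1\<close>. This identifies \<open>K_ext m n a\<close> with
  \<open>K_base (m * n) a\<close>.\<close>

lemma abs_trace_rel_trace:
  assumes "(3 :: 'a::field) = 0"
  shows "abs_trace m (rel_trace (3 ^ m) n b) = abs_trace (m * n) (b :: 'a)"
proof -
  have "abs_trace m (rel_trace (3 ^ m) n b) = (\<Sum>j<m. \<Sum>i<n. b ^ 3 ^ (i * m + j))"
    unfolding abs_trace_def rel_trace_def sum_power_3_power[OF assms]
    by (intro sum.cong) (simp_all add: power_add mult.commute flip: power_mult)
  also have "\<dots> = (\<Sum>i<n. \<Sum>j<m. b ^ 3 ^ (i * m + j))" by (rule sum.swap)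
  also have "\<dots> = (\<Sum>i<n. sum (\<lambda>k. b ^ 3 ^ k) {i * m..<i * m + m})"
    by (simp add: sum.atLeastLessThan_shift_0 atLeast0LessThan)
  also have "\<dots> = abs_trace (m * n) b"
    by (simp add: sum.nat_group abs_trace_def mult.commute)
  finally show ?thesis .
qed

theorem theorem2:
  fixes a :: "'b::{field, finite}" and m n h s :: nat
  assumes "card (UNIV :: 'b set) = 3 ^ (m * n)"
    and "m \<ge> 2" and "n \<ge> 2"
    and "n = 3 ^ h * s" and "coprime s 3"
    and "a \<in> Fq (3 ^ m)" and "a \<noteq> 0"
  shows "H_ext m n a = H_base m a + h"
proof -
  have "(3 :: 'b) ^ (m * n) = 0"
    using of_nat_card_UNIV[where ?'a = 'b] assms(1) by simp
  then have three: "(3 :: 'b) = 0" by simp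
  have "card (Fq (3 ^ m) :: 'b set) = 3 ^ m"
    using card_Fq[OF assms(1)] assms(2,3) three by simp
  then interpret base: ternary_extension "Fq (3 ^ m) :: 'b set" m n
    using three assms(1,3) by unfold_locales auto
  have "(UNIV :: 'b set) = Fq (3 ^ (m * n))"
    using power_card_UNIV[where ?'a = 'b] assms(1) by (auto simp: Fq_def)
  \<comment> \<open>This second instance provides integrality and the size bound for
    \<open>K_ext\<close>.\<close>
  then interpret ext: ternary_subfield "UNIV :: 'b set" "m * n"
    using three assms(1) by unfold_locales
  have K_ext_base: "K_ext m n a = K_base (m * n) a"
    by (simp add: K_ext_def K_base_def abs_trace_rel_trace[OF three] flip: ext.F_def)
  obtain K where K: "K_base m a = of_int K" "3 dvd K" "\<bar>K\<bar> < 3 ^ m"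
    using base.kloosterman_divisible[OF assms(6,2)] by blast
  have "2 * 1 \<le> m * n" using assms(2,3) by (intro mult_le_mono) auto
  then obtain L where L: "K_ext m n a = of_int L" "\<bar>L\<bar> < 3 ^ (m * n)"
    using ext.kloosterman_divisible[of a] K_ext_base by auto
  define t where "t = 1 - K"
  have power_sum: "base.kl_power_sum a k = of_int (lucas t (3 ^ m) k)" if "0 < k" for k
    using that
  proof (induction k rule: less_induct)
    case (less k)
    consider "k = 1" | "k = 2" | "3 \<le> k" using less.prems by linarith
    then show ?case
    proof cases
      case 1
      then show ?thesis using base.kl_power_sum_recurrence(1)[OF assms(6,7)] K(1) by (simp add: t_def)
    next
      case 2
      then show ?thesis using base.kl_power_sum_recurrence(2)[OF assms(6,7)] K(1)
        by (simp add: t_def numeral_2_eq_2 power2_eq_square)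
    next
      case 3
      define j where "j = k - 2"
      have j: "k = Suc (Suc j)" "0 < j" using 3 by (auto simp: j_def)
      then show ?thesis
        using base.kl_power_sum_recurrence(3)[OF assms(6,7) 3] less.IH[of j] less.IH[of "Suc j"] K(1)
        by (simp add: t_def)
    qed
  qed
  have "of_int L = (of_int (1 - lucas t (3 ^ m) n) :: complex)"
    using base.K_ext_eq[OF assms(6)] power_sum[of n] assms(3) L(1) by simp
  \<comment> \<open>Adding \<open>q^n\<close> turns \<open>1 - \<alpha>^n - \<beta>^n\<close> into
    \<open>(1 - \<alpha>^n) * (1 - \<beta>^n)\<close>, to which lifting the exponent
    applies.\<close>
  then have "L + 3 ^ (m * n) = lucas_norm t (3 ^ m) n"
    by (simp only: of_int_eq_iff) (simp add: lucas_norm_def power_mult)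
  then have ext_val: "H_ext m n a = multiplicity 3 (lucas_norm t (3 ^ m) n)"
    using val3_of_int[OF L(2)] L(1) by (simp add: H_ext_def)
  have "K + 3 ^ m = lucas_norm t (3 ^ m) 1" by (simp add: lucas_norm_def t_def)
  then have base_val: "H_base m a = multiplicity 3 (lucas_norm t (3 ^ m) 1)"
      and ne: "lucas_norm t (3 ^ m) 1 \<noteq> 0"
    using val3_of_int[OF K(3)] K by (auto simp: H_base_def)
  \<comment> \<open>Here \<open>m \<ge> 2\<close> gives the divisibility by 9 required for lifting
    the exponent.\<close>
  have "(3 :: int) ^ 2 dvd 3 ^ m" using assms(2) by (rule le_imp_power_dvd)
  then have "9 dvd (3 :: int) ^ m" by simp
  moreover have "3 dvd t - 1" using K(2) by (simp add: t_def)
  ultimately show ?thesis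
    using multiplicity_lucas_norm[OF _ _ ne assms(5)] ext_val base_val assms(4) by simp
qed

end
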